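(* Let $q>1$, let $m\geq 1$ be an integer, and let $\rho = 1/q^{m}$. Then a Bryc process (stationary random field with linear regressions) with parameters $(\rho,q)$ exists; that is, there exist a probability space and a random process $(X_k)_{k\in\mathbb{Z}}$ on it which is a Bryc process with parameters $(\rho,q)$.
   Context: Definition (Bryc process / Bryc random field with parameters $(\rho,q)$, $0<|\rho|<1$). It is a strictly stationary sequence $(X_k)_{k\in\mathbb{Z}}$ of real square-integrable random variables with $\mathbb{E}X_k=0$, $\mathbb{E}X_k^2=1$, $\mathbb{E}(X_kX_{k+1})=\rho$ for all $k$, such that, writing $\mathcal{F}_{\neq k}$ for the $\sigma$-algebra generated by all $X_j$ with $j\neq k$, for every $k\in\mathbb{Z}$ almost surely $$\mathbb{E}(X_k\mid \mathcal{F}_{\neq k}) = L\,(X_{k-1}+X_{k+1}),$$ $$\mathbb{E}(X_k^2\mid \mathcal{F}_{\neq k}) = A\,(X_{k-1}^2+X_{k+1}^2)+B\,X_{k-1}X_{k+1}+C,$$ where $$L=\frac{\rho}{1+\rho^2},\quad A=\frac{\rho^2(1-q\rho^2)}{(1+\rho^2)(1-q\rho^4)},\quad B=\frac{\rho^2(1-\rho^2)(1+q)}{(1+\rho^2)(1-q\rho^4)},\quad C=\frac{(1-\rho^2)^2}{1-q\rho^4}.$$ *)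

theory Defs
  imports "HOL-Probability.Probability"
begin

definition bryc_L :: "real \<Rightarrow> real" where
  "bryc_L \<rho> = \<rho> / (1 + \<rho>\<^sup>2)"

definition bryc_A :: "real \<Rightarrow> real \<Rightarrow> real" where
  "bryc_A \<rho> q = \<rho>\<^sup>2 * (1 - q * \<rho>\<^sup>2) / ((1 + \<rho>\<^sup>2) * (1 - q * \<rho> ^ 4))"

definition bryc_B :: "real \<Rightarrow> real \<Rightarrow> real" where
  "bryc_B \<rho> q = \<rho>\<^sup>2 * (1 - \<rho>\<^sup>2) * (1 + q) / ((1 + \<rho>\<^sup>2) * (1 - q * \<rho> ^ 4))"

definition bryc_C :: "real \<Rightarrow> real \<Rightarrow> real" where
  "bryc_C \<rho> q = (1 - \<rho>\<^sup>2)\<^sup>2 / (1 - q * \<rho> ^ 4)"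

text \<open>The \<open>\<sigma>\<close>-algebra generated by all \<open>X j\<close> with \<open>j \<noteq> k\<close>; only the space and the
  measurable sets of this measure are relevant.\<close>

definition sigma_others :: "'a measure \<Rightarrow> (int \<Rightarrow> 'a \<Rightarrow> real) \<Rightarrow> int \<Rightarrow> 'a measure" where
  "sigma_others M X k =
     sigma (space M) {X j -` S \<inter> space M | j S. j \<noteq> k \<and> S \<in> sets borel}"

text \<open>Strict stationarity: the law of the process on the path space
  \<open>\<real>\<^bsup>\<int>\<^esup>\<close> (with the product \<open>\<sigma>\<close>-algebra) is invariant under all shifts.\<close>

definition strictly_stationary :: "'a measure \<Rightarrow> (int \<Rightarrow> 'a \<Rightarrow> real) \<Rightarrow> bool" where
  "strictly_stationary M X \<longleftrightarrow>
     (\<forall>h::int. distr M (Pi\<^sub>M UNIV (\<lambda>_. borel)) (\<lambda>\<omega> k. X (k + h) \<omega>) =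
               distr M (Pi\<^sub>M UNIV (\<lambda>_. borel)) (\<lambda>\<omega> k. X k \<omega>))"

locale bryc_process = prob_space M
  for M :: "'a measure" and X :: "int \<Rightarrow> 'a \<Rightarrow> real" and \<rho> q :: real +
  assumes rho_range: "0 < \<bar>\<rho>\<bar>" "\<bar>\<rho>\<bar> < 1"
    and random_variable_X: "random_variable borel (X k)"
    and square_integrable_X: "integrable M (\<lambda>\<omega>. (X k \<omega>)\<^sup>2)"
    and stationary_X: "strictly_stationary M X"
    and mean_X: "expectation (X k) = 0"
    and second_moment_X: "expectation (\<lambda>\<omega>. (X k \<omega>)\<^sup>2) = 1"
    and correlation_X: "expectation (\<lambda>\<omega>. X k \<omega> * X (k + 1) \<omega>) = \<rho>"
    and linear_regression:
      "AE \<omega> in M. real_cond_exp M (sigma_others M X k) (X k) \<omega> =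
         bryc_L \<rho> * (X (k - 1) \<omega> + X (k + 1) \<omega>)"
    and quadratic_regression:
      "AE \<omega> in M. real_cond_exp M (sigma_others M X k) (\<lambda>\<omega>. (X k \<omega>)\<^sup>2) \<omega> =
         bryc_A \<rho> q * ((X (k - 1) \<omega>)\<^sup>2 + (X (k + 1) \<omega>)\<^sup>2) +
         bryc_B \<rho> q * X (k - 1) \<omega> * X (k + 1) \<omega> + bryc_C \<rho> q"

end

theory Submission
  imports Defs
begin

text \<open>
  Put \<open>r = \<surd>q\<close>. On the lattice of points \<open>x\<^sub>k = (r\<^sup>k - r\<^sup>-\<^sup>k) / \<surd>(q - 1)\<close>, the nearest-neighbour
  chain stepping up from \<open>x\<^sub>k\<close> with probability \<open>1 / (1 + q\<^sup>k)\<close> is reversible, with stationary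
  weights proportional to \<open>w\<^sub>k + w\<^sub>k\<^sub>-\<^sub>1\<close>, \<open>w\<^sub>k = r\<^sup>-\<^sup>k\<^sup>(\<^sup>k\<^sup>+\<^sup>1\<^sup>)\<close>. Its transition operator \<open>T\<close> and the
  multiplication \<open>F\<close> by the position satisfy
  \<open>T\<^sup>2F + FT\<^sup>2 = (r + 1/r) TFT\<close> and \<open>TF\<^sup>2T - FT\<^sup>2F = (1 - 1/q) T\<^sup>2\<close>. Consequently \<open>A\<^sup>+ = r FT - TF\<close> and
  \<open>A\<^sup>- = TF - FT / r\<close> act like the creation and annihilation operators of a \<open>q\<close>-oscillator:
  \<open>TA\<^sup>+ = A\<^sup>+T / r\<close>, \<open>TA\<^sup>- = r A\<^sup>-T\<close> and \<open>A\<^sup>-A\<^sup>+ - A\<^sup>+A\<^sup>-\<close> is a multiple of \<open>T\<^sup>2\<close>. Writing \<open>P = T\<^sup>n\<close> and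
  expressing \<open>PFP\<close>, \<open>FP\<^sup>2\<close>, \<open>P\<^sup>2F\<close>, \<open>PF\<^sup>2P\<close>, \<open>F\<^sup>2P\<^sup>2\<close>, \<open>P\<^sup>2F\<^sup>2\<close>, \<open>FP\<^sup>2F\<close> through them gives
  \<open>PFP = L (FP\<^sup>2 + P\<^sup>2F)\<close> and \<open>PF\<^sup>2P = A (F\<^sup>2P\<^sup>2 + P\<^sup>2F\<^sup>2) + B FP\<^sup>2F + C P\<^sup>2\<close> for \<open>\<rho> = r\<^sup>-\<^sup>n\<close>. By the
  Markov property these are exactly the two regression identities for the stationary two-sided
  chain with transition operator \<open>P\<close>; for \<open>n = 2m\<close> one gets \<open>\<rho> = 1 / q\<^sup>m\<close>.
\<close>

section \<open>The oscillator algebra\<close>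

locale q_oscillator =
  fixes T :: "('a \<Rightarrow> real) \<Rightarrow> 'a \<Rightarrow> real" and f :: "'a \<Rightarrow> real" and r :: real
  assumes r_gt_1: "1 < r"
    and T_lin: "T (\<lambda>x. a * g x + b * h x) = (\<lambda>x. a * T g x + b * T h x)"
    and cubic: "T (T (\<lambda>x. f x * g x)) x + f x * T (T g) x = (r + 1 / r) * T (\<lambda>y. f y * T g y) x"
    and commutation: "T (\<lambda>y. f y * (f y * T g y)) x - f x * T (T (\<lambda>y. f y * g y)) x =
      (1 - 1 / r\<^sup>2) * T (T g) x"
begin

definition mult_f :: "('a \<Rightarrow> real) \<Rightarrow> 'a \<Rightarrow> real" where
  "mult_f g = (\<lambda>x. f x * g x)"

text \<open>
  \<open>T\<close> is not assumed invertible, so instead of the ladder operators \<open>a\<^sup>+\<close>, \<open>a\<^sup>-\<close> with \<open>F = a\<^sup>+ + a\<^sup>-\<close>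
  only the products \<open>a\<^sup>+T\<close> and \<open>a\<^sup>-T\<close>, scaled by \<open>r - 1/r\<close>, are available.
\<close>

definition raise :: "('a \<Rightarrow> real) \<Rightarrow> 'a \<Rightarrow> real" where
  "raise g = (\<lambda>x. r * mult_f (T g) x - T (mult_f g) x)"

definition lower :: "('a \<Rightarrow> real) \<Rightarrow> 'a \<Rightarrow> real" where
  "lower g = (\<lambda>x. T (mult_f g) x - mult_f (T g) x / r)"

definition linop :: "(('a \<Rightarrow> real) \<Rightarrow> 'a \<Rightarrow> real) \<Rightarrow> bool" where
  "linop U \<longleftrightarrow> (\<forall>a b g h. U (\<lambda>x. a * g x + b * h x) = (\<lambda>x. a * U g x + b * U h x))"

lemma linopD: "linop U \<Longrightarrow> U (\<lambda>x. a * g x + b * h x) = (\<lambda>x. a * U g x + b * U h x)"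
  by (simp add: linop_def)

lemma linop_simps:
  assumes "linop U"
  shows "U (\<lambda>x. g x + h x) = (\<lambda>x. U g x + U h x)" "U (\<lambda>x. g x - h x) = (\<lambda>x. U g x - U h x)"
    "U (\<lambda>x. a * g x) = (\<lambda>x. a * U g x)" "U (\<lambda>x. g x / a) = (\<lambda>x. U g x / a)"
  using linopD[OF assms, of 1 g 1 h] linopD[OF assms, of 1 g "-1" h] linopD[OF assms, of a g 0 h]
    linopD[OF assms, of "1/a" g 0 h]
  by simp_all

lemma linop_T: "linop T"
  by (simp add: linop_def T_lin)

lemma linop_mult_f: "linop mult_f"
  by (simp add: linop_def mult_f_def algebra_simps)

lemma linop_funpow: "linop U \<Longrightarrow> linop (U ^^ n)"
  by (induction n) (auto simp: linop_def)

lemmas T_simps = linop_simps[OF linop_T] and mult_f_simps = linop_simps[OF linop_mult_f]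

lemma linop_raise: "linop raise" and linop_lower: "linop lower"
  by (auto simp: linop_def raise_def lower_def T_simps mult_f_simps field_simps
      simp flip: diff_divide_distrib add_divide_distrib)

lemmas raise_simps = linop_simps[OF linop_raise] and lower_simps = linop_simps[OF linop_lower]

lemma cubic': "T (T (mult_f g)) x = (r + 1 / r) * T (mult_f (T g)) x - mult_f (T (T g)) x"
  using cubic[of g x] by (simp add: mult_f_def)

text \<open>Replacing \<open>TTF\<close> by means of \<open>cubic'\<close> leaves only multiples of
  \<open>TFT\<close> and \<open>FTT\<close>. The coefficients \<open>r\<close> and
  \<open>1 / r\<close> chosen in \<open>raise\<close> and \<open>lower\<close> are the two roots of
  \<open>z\<^sup>2 - (r + 1/r) z + 1\<close>, which is exactly the condition for such a combination
  to commute with \<open>T\<close> up to a scalar.\<close>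

lemma T_raise: "T (raise g) = (\<lambda>x. raise (T g) x / r)"
  and T_lower: "T (lower g) = (\<lambda>x. r * lower (T g) x)"
  using r_gt_1 by (auto simp: raise_def lower_def T_simps cubic' field_simps)

lemma funpow_T_raise: "(T ^^ n) (raise g) = (\<lambda>x. raise ((T ^^ n) g) x / r ^ n)"
  and funpow_T_lower: "(T ^^ n) (lower g) = (\<lambda>x. r ^ n * lower ((T ^^ n) g) x)"
  by (induction n) (simp_all add: T_raise T_lower T_simps raise_simps lower_simps field_simps)

definition gap :: real where "gap = r - 1 / r"

lemma gap_pos: "gap > 0"
  unfolding gap_def using r_gt_1 by (smt (verit) divide_less_eq_1_pos)

text \<open>This and \<open>T_mult_f\<close> solve the definitions of \<open>raise\<close> and
  \<open>lower\<close> for the two products of \<open>mult_f\<close> and \<open>T\<close>. The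
  determinant of that linear system is \<open>gap\<close>.\<close>

lemma mult_f_T: "mult_f (T g) = (\<lambda>x. (raise g x + lower g x) / gap)"
proof
  fix x have "raise g x + lower g x = gap * mult_f (T g) x"
    by (simp add: gap_def raise_def lower_def algebra_simps)
  then show "mult_f (T g) x = (raise g x + lower g x) / gap" using gap_pos by simp
qed

lemma T_mult_f: "T (mult_f g) = (\<lambda>x. (raise g x / r + r * lower g x) / gap)"
proof
  fix x have "raise g x / r + r * lower g x = gap * T (mult_f g) x"
    using r_gt_1 by (simp add: gap_def raise_def lower_def field_simps)
  then show "T (mult_f g) x = (raise g x / r + r * lower g x) / gap" using gap_pos by simp
qed

text \<open>In the commutator of \<open>lower\<close> and \<open>raise\<close> the products
  \<open>TFTF\<close> and \<open>FTFT\<close> cancel, and what remains is \<open>gap\<close> times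
  the left-hand side of \<open>commutation\<close>.\<close>

lemma lower_raise: "gap\<^sup>2 * T (T g) x = r * (lower (raise g) x - raise (lower g) x)"
proof -
  have "lower (raise g) x - raise (lower g) x =
      gap * (T (mult_f (mult_f (T g))) x - mult_f (T (T (mult_f g))) x)"
    using r_gt_1 by (simp add: gap_def raise_def lower_def T_simps mult_f_simps field_simps)
  also have "\<dots> = gap * ((1 - 1 / r\<^sup>2) * T (T g) x)"
    using commutation[of g x] by (simp add: mult_f_def)
  also have "1 - 1 / r\<^sup>2 = gap / r"
    using r_gt_1 by (simp add: gap_def field_simps power2_eq_square)
  finally show ?thesis using r_gt_1 by (simp add: power2_eq_square)
qed

lemma funpow_swap: "(T ^^ n) (T g) = T ((T ^^ n) g)"
  by (metis funpow_swap1)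

section \<open>Regression identities for powers of the transition operator\<close>

context
  fixes n :: nat and \<rho> :: real and P :: "('a \<Rightarrow> real) \<Rightarrow> 'a \<Rightarrow> real"
  assumes n: "0 < n" and \<rho>: "\<rho> = 1 / r ^ n" and P: "P = T ^^ n"
begin

lemma linear_regression_operator:
  "P (mult_f (P g)) x = bryc_L \<rho> * (mult_f (P (P g)) x + P (P (mult_f g)) x)"
proof -
  \<comment> \<open>One factor \<open>T\<close> is split off each \<open>P\<close>, since
    \<open>mult_f\<close> is expressible through \<open>raise\<close> and \<open>lower\<close> only
    next to a \<open>T\<close>.\<close>
  obtain k where k: "n = Suc k" using n by (cases n) auto
  define R where "R = r ^ k"
  define Q where "Q = T ^^ k"
  have R: "R > 0" and r: "r > 0" using r_gt_1 by (auto simp: R_def)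
  have gap: "gap \<noteq> 0" using gap_pos by simp
  have PQ: "P g = T (Q g)" for g by (simp add: P k Q_def)
  have QT: "Q (T g) = T (Q g)" for g by (simp add: Q_def funpow_swap)
  note Q_simps = linop_simps[OF linop_funpow[OF linop_T], of k, folded Q_def]
  have Qr: "Q (raise g) = (\<lambda>x. raise (Q g) x / R)" "Q (lower g) = (\<lambda>x. R * lower (Q g) x)" for g
    by (simp_all add: Q_def R_def funpow_T_raise funpow_T_lower)
  \<comment> \<open>All three terms of the claim become combinations of these two values: moving a
    ladder operator past \<open>T\<^sup>n\<close> only multiplies it by \<open>r\<^sup>n\<close> or
    its inverse. An identity in \<open>s = r\<^sup>n\<close> remains.\<close>
  define \<alpha> \<beta> where "\<alpha> = raise (T (Q (Q g))) x" and "\<beta> = lower (T (Q (Q g))) x"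
  have 1: "gap * P (mult_f (P g)) x = \<alpha> / (r * R) + r * R * \<beta>"
    using gap r R by (simp add: PQ mult_f_T Q_simps T_simps T_raise T_lower Qr \<alpha>_def \<beta>_def field_simps)
  have 2: "gap * mult_f (P (P g)) x = \<alpha> + \<beta>"
    using gap by (simp add: PQ mult_f_T QT \<alpha>_def \<beta>_def)
  have "P (P (mult_f g)) = Q (Q (T (T (mult_f g))))"
    by (simp add: PQ QT)
  then have 3: "gap * P (P (mult_f g)) x = \<alpha> / (r * R)\<^sup>2 + (r * R)\<^sup>2 * \<beta>"
    using gap r R by (simp add: T_mult_f Q_simps T_simps T_raise T_lower Qr \<alpha>_def \<beta>_def QT
        raise_simps lower_simps power2_eq_square field_simps)
  define s where "s = r * R"
  have s: "s > 0" using r R by (simp add: s_def)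
  have \<rho>s: "\<rho> = 1 / s" by (simp add: \<rho> k s_def R_def)
  have L: "bryc_L \<rho> = s / (s\<^sup>2 + 1)"
    using s by (simp add: bryc_L_def \<rho>s field_simps power2_eq_square)
  have s2: "s\<^sup>2 + 1 \<noteq> 0" by (metis add.commute power_one sum_power2_eq_zero_iff zero_neq_one)
  have "(s\<^sup>2 + 1) * (gap * P (mult_f (P g)) x) =
      s * (gap * mult_f (P (P g)) x + gap * P (P (mult_f g)) x)"
    unfolding 1 2 3 s_def[symmetric] using s by (simp add: field_simps power2_eq_square)
  then have "gap * ((s\<^sup>2 + 1) * P (mult_f (P g)) x) =
      gap * (s * (mult_f (P (P g)) x + P (P (mult_f g)) x))"
    by (simp only: distrib_left mult.left_commute mult.assoc)
  then have "(s\<^sup>2 + 1) * P (mult_f (P g)) x = s * (mult_f (P (P g)) x + P (P (mult_f g)) x)"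
    using gap by (metis mult_left_cancel)
  then show ?thesis
    using s2 by (simp add: L field_simps)
qed

lemma quadratic_regression_operator:
  assumes q: "q = r\<^sup>2" and n2: "2 \<le> n"
  shows "P (mult_f (mult_f (P g))) x =
    bryc_A \<rho> q * (mult_f (mult_f (P (P g))) x + P (P (mult_f (mult_f g))) x) +
    bryc_B \<rho> q * mult_f (P (P (mult_f g))) x + bryc_C \<rho> q * P (P g) x"
proof -
  obtain k where k: "n = Suc k" using n by (cases n) auto
  define R where "R = r ^ k"
  define Q where "Q = T ^^ k"
  have R: "R > 0" and r: "r > 0" using r_gt_1 by (auto simp: R_def)
  have gap: "gap \<noteq> 0" using gap_pos by simp
  have PQ: "P g = T (Q g)" for g by (simp add: P k Q_def)
  have QT: "Q (T g) = T (Q g)" for g by (simp add: Q_def funpow_swap)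
  note Q_simps = linop_simps[OF linop_funpow[OF linop_T], of k, folded Q_def]
  have Qr: "Q (raise g) = (\<lambda>x. raise (Q g) x / R)" "Q (lower g) = (\<lambda>x. R * lower (Q g) x)" for g
    by (simp_all add: Q_def R_def funpow_T_raise funpow_T_lower)
  have rT: "raise (T g) = (\<lambda>x. r * T (raise g) x)" "lower (T g) = (\<lambda>x. T (lower g) x / r)" for g
    using r by (simp_all add: T_raise T_lower)
  define h where "h = Q (Q g)"
  \<comment> \<open>Two factors \<open>mult_f\<close> absorb two factors \<open>T\<close>, so
    products of two ladder operators act on \<open>h\<close> with no \<open>T\<close> left over. The
    five equations below expand every term of the claim in these four values.\<close>
  define \<alpha> \<beta> \<gamma> \<delta> where "\<alpha> = raise (raise h) x" and "\<beta> = raise (lower h) x"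
    and "\<gamma> = lower (raise h) x" and "\<delta> = lower (lower h) x"
  define s where "s = r * R"
  have s: "s > 0" using r R by (simp add: s_def)
  have \<rho>s: "\<rho> = 1 / s" by (simp add: \<rho> k s_def R_def)
  note defs = \<alpha>_def \<beta>_def \<gamma>_def \<delta>_def h_def s_def
  note simps = Q_simps T_simps raise_simps lower_simps mult_f_simps
  have 1: "gap\<^sup>2 * P (mult_f (mult_f (P g))) x = r / s\<^sup>2 * \<alpha> + \<beta> / r + r * \<gamma> + s\<^sup>2 / r * \<delta>"
  proof -
    have eq: "P (mult_f (mult_f (P g))) x = Q (T (mult_f (mult_f (T (Q g))))) x"
      by (simp add: PQ QT)
    show ?thesis
      unfolding eq using gap r R by (simp add: mult_f_T T_mult_f simps Qr power2_eq_square defs field_simps)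
  qed
  have 2: "gap\<^sup>2 * mult_f (mult_f (P (P g))) x = r * \<alpha> + \<beta> / r + r * \<gamma> + \<delta> / r"
  proof -
    have eq: "mult_f (mult_f (P (P g))) x = mult_f (mult_f (T (T h))) x"
      by (simp add: PQ QT h_def)
    show ?thesis
      unfolding eq using gap r R by (simp add: mult_f_T simps rT power2_eq_square defs field_simps)
  qed
  have 3: "gap\<^sup>2 * P (P (mult_f (mult_f g))) x = r / s^4 * \<alpha> + \<beta> / r + r * \<gamma> + s^4 / r * \<delta>"
  proof -
    have "P (P (mult_f (mult_f g))) x = Q (Q (T (T (mult_f (mult_f g))))) x"
      by (simp add: PQ QT)
    also have "T (T (mult_f (mult_f g))) =
        (\<lambda>x. (raise (raise g) x / r^3 + raise (lower g) x / r + r * lower (raise g) x + r^3 * lower (lower g) x) / (gap * gap))"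
      using r gap by (simp add: T_mult_f simps T_raise T_lower fun_eq_iff field_simps power3_eq_cube)
    finally have eq: "P (P (mult_f (mult_f g))) x = Q (Q
        (\<lambda>x. (raise (raise g) x / r^3 + raise (lower g) x / r + r * lower (raise g) x + r^3 * lower (lower g) x) / (gap * gap))) x" .
    show ?thesis
      unfolding eq using gap r R by (simp add: simps Qr power2_eq_square power4_eq_xxxx power3_eq_cube defs field_simps)
  qed
  have 4: "gap\<^sup>2 * mult_f (P (P (mult_f g))) x = r / s\<^sup>2 * \<alpha> + s\<^sup>2 / r * \<beta> + r / s\<^sup>2 * \<gamma> + s\<^sup>2 / r * \<delta>"
  proof -
    have eq: "mult_f (P (P (mult_f g))) x = mult_f (T (Q (Q (T (mult_f g))))) x"
      by (simp add: PQ QT)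
    show ?thesis
      unfolding eq using gap r R by (simp add: mult_f_T T_mult_f simps Qr power2_eq_square defs field_simps)
  qed
  \<comment> \<open>The constant term of the regression enters here: \<open>P\<^sup>2\<close> is a
    commutator of ladder operators, so it contributes to \<open>\<beta>\<close> and
    \<open>\<gamma>\<close> only.\<close>
  have 5: "gap\<^sup>2 * P (P g) x = r * \<gamma> - r * \<beta>"
    using lower_raise[of h x] by (simp add: PQ QT defs right_diff_distrib)
  \<comment> \<open>From \<open>2 \<le> n\<close> one gets \<open>s > r\<close>, hence
    \<open>s ^ 4 > r\<^sup>2\<close>, so the denominator \<open>1 - q * \<rho> ^ 4\<close> of the
    coefficients is positive.\<close>
  have sr: "s > r"
  proof -
    have "k > 0" using n2 k by simp
    then have "R > 1" using r_gt_1 by (simp add: R_def)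
    then show ?thesis using r by (simp add: s_def)
  qed
  have d: "s ^ 4 - r\<^sup>2 > 0"
  proof -
    have "r * r < s * s" using sr r by (intro mult_strict_mono) auto
    moreover have "s * s * 1 \<le> s * s * (s * s)"
      using sr r_gt_1 by (intro mult_left_mono) (auto intro: order.trans[OF _ mult_mono[of 1 s 1 s]])
    ultimately show ?thesis by (simp add: power4_eq_xxxx power2_eq_square)
  qed
  have s2: "s\<^sup>2 + 1 > 0" by (simp add: add_nonneg_pos)
  define D where "D = (s\<^sup>2 + 1) * (s ^ 4 - r\<^sup>2)"
  have D: "D > 0" using d s2 by (simp add: D_def)
  have den: "1 - q * \<rho> ^ 4 = (s ^ 4 - r\<^sup>2) / s ^ 4" "1 + \<rho>\<^sup>2 = (s\<^sup>2 + 1) / s\<^sup>2"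
    using s by (simp_all add: q \<rho>s field_simps)
  have A: "bryc_A \<rho> q = s\<^sup>2 * (s\<^sup>2 - r\<^sup>2) / D"
    unfolding bryc_A_def den D_def using s d s2
    by (simp add: q \<rho>s divide_simps)
  have B: "bryc_B \<rho> q = s\<^sup>2 * (s\<^sup>2 - 1) * (1 + r\<^sup>2) / D"
    unfolding bryc_B_def den D_def using s d s2
    by (simp add: q \<rho>s divide_simps)
  have C: "bryc_C \<rho> q = (s\<^sup>2 - 1)\<^sup>2 * (s\<^sup>2 + 1) / D"
    unfolding bryc_C_def den D_def using s d s2
    by (simp add: q \<rho>s divide_simps)
  \<comment> \<open>With the denominator \<open>D\<close> cleared, the claim amounts to one identity
    in \<open>r\<close> and \<open>s\<close> for each of the coefficients of
    \<open>\<alpha>\<close>, \<open>\<beta>\<close>, \<open>\<gamma>\<close> and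
    \<open>\<delta>\<close>.\<close>
  have "D * (r / s\<^sup>2 * \<alpha> + \<beta> / r + r * \<gamma> + s\<^sup>2 / r * \<delta>) =
      s\<^sup>2 * (s\<^sup>2 - r\<^sup>2) * ((r * \<alpha> + \<beta> / r + r * \<gamma> + \<delta> / r) + (r / s^4 * \<alpha> + \<beta> / r + r * \<gamma> + s^4 / r * \<delta>)) +
      s\<^sup>2 * (s\<^sup>2 - 1) * (1 + r\<^sup>2) * (r / s\<^sup>2 * \<alpha> + s\<^sup>2 / r * \<beta> + r / s\<^sup>2 * \<gamma> + s\<^sup>2 / r * \<delta>) +
      (s\<^sup>2 - 1)\<^sup>2 * (s\<^sup>2 + 1) * (r * \<gamma> - r * \<beta>)"
    unfolding D_def using s r
    by (simp add: divide_simps) (simp add: algebra_simps power2_eq_square power4_eq_xxxx)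
  then have "gap\<^sup>2 * (D * P (mult_f (mult_f (P g))) x) = gap\<^sup>2 * (
      s\<^sup>2 * (s\<^sup>2 - r\<^sup>2) * (mult_f (mult_f (P (P g))) x + P (P (mult_f (mult_f g))) x) +
      s\<^sup>2 * (s\<^sup>2 - 1) * (1 + r\<^sup>2) * mult_f (P (P (mult_f g))) x +
      (s\<^sup>2 - 1)\<^sup>2 * (s\<^sup>2 + 1) * P (P g) x)"
    unfolding 1[symmetric] 2[symmetric] 3[symmetric] 4[symmetric] 5[symmetric]
    by (simp only: distrib_left mult.left_commute mult.assoc)
  then have "D * P (mult_f (mult_f (P g))) x =
      s\<^sup>2 * (s\<^sup>2 - r\<^sup>2) * (mult_f (mult_f (P (P g))) x + P (P (mult_f (mult_f g))) x) +
      s\<^sup>2 * (s\<^sup>2 - 1) * (1 + r\<^sup>2) * mult_f (P (P (mult_f g))) x +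
      (s\<^sup>2 - 1)\<^sup>2 * (s\<^sup>2 + 1) * P (P g) x"
    using gap by (metis mult_left_cancel power_not_zero)
  then show ?thesis
    unfolding A B C using D by (simp add: divide_simps) (simp add: algebra_simps)
qed

end

end

section \<open>The lattice chain\<close>

locale q_lattice =
  fixes r :: real
  assumes r_gt_1: "1 < r"
begin

definition "width = sqrt (r\<^sup>2 - 1)"

text \<open>A multiple of \<open>sinh (k ln r)\<close>. The factor \<open>width\<close> makes the
  stationary second moment equal to 1.\<close>

definition "pt k = (r powi k - 1 / r powi k) / width" for k :: int

definition up :: "int \<Rightarrow> real" where
  "up k = 1 / (1 + (r powi k)\<^sup>2)"

definition step :: "(int \<Rightarrow> real) \<Rightarrow> int \<Rightarrow> real" where
  "step g k = up k * g (k + 1) + (1 - up k) * g (k - 1)"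

lemma r_pos: "0 < r" and r_square_gt_1: "1 < r\<^sup>2"
  using r_gt_1 by simp_all

lemma powi_pos: "0 < r powi k"
  using r_pos by (rule zero_less_power_int)

lemma powi_nonzero: "r powi k \<noteq> 0"
  by (rule less_imp_neq[OF powi_pos, symmetric])

lemma powi_succ: "r powi (k + 1) = r powi k * r" and powi_pred: "r powi (k - 1) = r powi k / r"
  using r_pos by (simp_all add: power_int_add power_int_diff)

lemma up_bounds: "0 < up k" "up k < 1"
proof -
  have "(r powi k)\<^sup>2 > 0" by (rule zero_less_power[OF powi_pos])
  then show "0 < up k" "up k < 1" unfolding up_def by (smt (verit) divide_less_eq_1 zero_less_divide_1_iff)+
qed

lemma step_weighted: "(1 + (r powi k)\<^sup>2) * step g k = g (k + 1) + (r powi k)\<^sup>2 * g (k - 1)"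
proof -
  have n: "1 + (r powi k)\<^sup>2 > 0" by (simp add: add_pos_nonneg)
  have "1 - up k = (r powi k)\<^sup>2 / (1 + (r powi k)\<^sup>2)"
    using n by (simp add: up_def field_simps)
  then show ?thesis using n by (simp add: step_def up_def distrib_left)
qed

lemma width_pos: "width > 0"
  using r_square_gt_1 unfolding width_def by (intro real_sqrt_gt_zero) linarith

lemma width_sq: "width\<^sup>2 = r\<^sup>2 - 1"
  using r_square_gt_1 unfolding width_def by (intro real_sqrt_pow2) linarith

lemma pt_eq:
  "width * pt k = r powi k - 1 / r powi k"
  "width * pt (k + 1) = r powi k * r - 1 / (r powi k * r)"
  "width * pt (k - 1) = r powi k / r - r / r powi k"
  using width_pos by (simp_all add: pt_def powi_succ powi_pred)

text \<open>The addition theorem for the hyperbolic sine. It makes the coefficients of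
  \<open>g (k + 2)\<close> and \<open>g (k - 2)\<close> in \<open>cubic\<close> vanish;
  \<open>pt_quadratic\<close>, an identity of Cassini type, does the same for
  \<open>commutation\<close>.\<close>

lemma pt_linear: "pt (k + 1) + pt (k - 1) = (r + 1 / r) * pt k"
proof -
  have "width * (pt (k + 1) + pt (k - 1)) = width * ((r + 1 / r) * pt k)"
    unfolding distrib_left mult.left_commute[of width] pt_eq[of k]
    using r_pos powi_pos[of k] by (simp add: field_simps)
  then show ?thesis using width_pos by (metis mult_left_cancel less_irrefl)
qed

lemma pt_quadratic: "(pt k)\<^sup>2 = pt (k - 1) * pt (k + 1) + (1 - 1 / r\<^sup>2)"
proof -
  let ?s = width
  have "(?s * pt k)\<^sup>2 = (?s * pt (k - 1)) * (?s * pt (k + 1)) + (r\<^sup>2 - 1) * (1 - 1 / r\<^sup>2)"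
    unfolding pt_eq[of k] using r_pos powi_pos[of k] by (simp add: field_simps power2_eq_square)
  also have "\<dots> = ?s\<^sup>2 * (pt (k - 1) * pt (k + 1) + (1 - 1 / r\<^sup>2))"
    unfolding width_sq[symmetric] by (simp add: algebra_simps power2_eq_square)
  finally show ?thesis using width_pos by (simp add: power_mult_distrib)
qed

text \<open>Together with \<open>step_pt_sq\<close> this yields the first two moments of the
  \<open>n\<close>-step kernel, from which the correlation of neighbours is computed.\<close>

lemma step_pt: "step pt k = pt k / r"
proof -
  let ?s = width
  have n: "1 + (r powi k)\<^sup>2 > 0" by (simp add: add_pos_nonneg)
  have "(1 + (r powi k)\<^sup>2) * (?s * step pt k) = (?s * pt (k+1)) + (r powi k)\<^sup>2 * (?s * pt (k-1))"
    using step_weighted[of k pt] by (simp add: mult.left_commute[of _ ?s] distrib_left)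
  also have "\<dots> = (1 + (r powi k)\<^sup>2) * (?s * (pt k / r))"
    unfolding times_divide_eq_right pt_eq[of k]
    using r_pos powi_pos[of k] by (simp add: field_simps power2_eq_square)
  finally have "?s * step pt k = ?s * (pt k / r)" using n by (metis mult_left_cancel less_irrefl)
  then show ?thesis using width_pos by (metis mult_left_cancel less_irrefl)
qed

lemma step_pt_sq: "step (\<lambda>k. (pt k)\<^sup>2) k = (pt k)\<^sup>2 / r\<^sup>2 + (1 - 1 / r\<^sup>2)"
proof -
  let ?s = width
  have n: "1 + (r powi k)\<^sup>2 > 0" by (simp add: add_pos_nonneg)
  have "(1 + (r powi k)\<^sup>2) * (?s\<^sup>2 * step (\<lambda>k. (pt k)\<^sup>2) k) =
      (?s * pt (k+1))\<^sup>2 + (r powi k)\<^sup>2 * (?s * pt (k-1))\<^sup>2"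
    using step_weighted[of k "\<lambda>k. (pt k)\<^sup>2"]
    by (simp add: mult.left_commute[of _ "?s\<^sup>2"] distrib_left power_mult_distrib)
  also have "\<dots> = (1 + (r powi k)\<^sup>2) * ((?s * pt k)\<^sup>2 / r\<^sup>2 + (r\<^sup>2 - 1) * (1 - 1 / r\<^sup>2))"
    unfolding pt_eq[of k] using r_pos powi_pos[of k] by (simp add: field_simps power2_eq_square)
  also have "\<dots> = (1 + (r powi k)\<^sup>2) * (?s\<^sup>2 * ((pt k)\<^sup>2 / r\<^sup>2 + (1 - 1 / r\<^sup>2)))"
    unfolding width_sq[symmetric] by (simp add: algebra_simps)
  finally have "?s\<^sup>2 * step (\<lambda>k. (pt k)\<^sup>2) k = ?s\<^sup>2 * ((pt k)\<^sup>2 / r\<^sup>2 + (1 - 1 / r\<^sup>2))"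
    using n by (metis mult_left_cancel less_irrefl)
  then show ?thesis using width_pos by simp
qed

section \<open>Two-step return probabilities and the oscillator relations\<close>

lemma up_return:
  "up k * (1 - up (k + 1)) * (1 + (r powi k)\<^sup>2) * (1 + (r powi k)\<^sup>2 * r\<^sup>2) = (r powi k)\<^sup>2 * r\<^sup>2"
  "(1 - up k) * up (k - 1) * (1 + (r powi k)\<^sup>2) * (r\<^sup>2 + (r powi k)\<^sup>2) = (r powi k)\<^sup>2 * r\<^sup>2"
proof -
  define u where "u = r powi k"
  have u: "u > 0" unfolding u_def by (rule powi_pos)
  have d: "1 + u\<^sup>2 > 0" "1 + u\<^sup>2 * r\<^sup>2 > 0" "r\<^sup>2 + u\<^sup>2 > 0" using u r_pos by (simp_all add: add_pos_nonneg)
  have 1: "1 - up (k + 1) = u\<^sup>2 * r\<^sup>2 / (1 + u\<^sup>2 * r\<^sup>2)"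
    using d unfolding up_def powi_succ u_def[symmetric] by (simp add: power_mult_distrib field_simps)
  have 2: "1 - up k = u\<^sup>2 / (1 + u\<^sup>2)"
    using d by (simp add: up_def u_def[symmetric] field_simps)
  have 3: "up (k - 1) = r\<^sup>2 / (r\<^sup>2 + u\<^sup>2)"
    using d r_pos unfolding up_def powi_pred u_def[symmetric] by (simp add: power_divide field_simps)
  show "up k * (1 - up (k + 1)) * (1 + (r powi k)\<^sup>2) * (1 + (r powi k)\<^sup>2 * r\<^sup>2) = (r powi k)\<^sup>2 * r\<^sup>2"
    unfolding 1 u_def[symmetric] using d by (simp add: up_def u_def[symmetric])
  show "(1 - up k) * up (k - 1) * (1 + (r powi k)\<^sup>2) * (r\<^sup>2 + (r powi k)\<^sup>2) = (r powi k)\<^sup>2 * r\<^sup>2"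
    unfolding 2 3 u_def[symmetric] using d by simp
qed

text \<open>
  The hypothesis is the conclusion multiplied by the common denominator of the two return
  probabilities, up to the factor \<open>(r powi k)\<^sup>2 * r\<^sup>2\<close>.
\<close>

lemma return_identity:
  assumes "a * (r\<^sup>2 + (r powi k)\<^sup>2) + b * (1 + (r powi k)\<^sup>2 * r\<^sup>2) = 0"
  shows "up k * (1 - up (k + 1)) * a + (1 - up k) * up (k - 1) * b = 0"
proof -
  define v where "v = (r powi k)\<^sup>2"
  have v: "v > 0" using powi_nonzero[of k] by (simp add: v_def)
  define s t where "s = up k * (1 - up (k + 1))" and "t = (1 - up k) * up (k - 1)"
  have st: "s * (1 + v) * (1 + v * r\<^sup>2) = v * r\<^sup>2" "t * (1 + v) * (r\<^sup>2 + v) = v * r\<^sup>2"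
    using up_return[of k] by (simp_all add: s_def t_def v_def)
  have ab: "a * (r\<^sup>2 + v) + b * (1 + v * r\<^sup>2) = 0" using assms by (simp add: v_def)
  have "(1 + v) * (1 + v * r\<^sup>2) * (r\<^sup>2 + v) * (s * a + t * b) =
    (s * (1 + v) * (1 + v * r\<^sup>2)) * (a * (r\<^sup>2 + v)) + (t * (1 + v) * (r\<^sup>2 + v)) * (b * (1 + v * r\<^sup>2))"
    by (simp add: algebra_simps)
  also have "\<dots> = v * r\<^sup>2 * (a * (r\<^sup>2 + v) + b * (1 + v * r\<^sup>2))"
    unfolding st by (simp add: algebra_simps)
  also have "\<dots> = 0" unfolding ab by simp
  finally have "(1 + v) * (1 + v * r\<^sup>2) * (r\<^sup>2 + v) * (s * a + t * b) = 0" .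
  moreover have "(1 + v) * (1 + v * r\<^sup>2) * (r\<^sup>2 + v) > 0"
    using v by (intro mult_pos_pos) (simp_all add: add_pos_nonneg add_nonneg_pos)
  ultimately have "s * a + t * b = 0" by (metis mult_eq_0_iff less_irrefl)
  then show ?thesis by (simp add: s_def t_def)
qed

text \<open>This is the coefficient of \<open>g k\<close> in \<open>cubic\<close>;
  \<open>return_quadratic\<close> is its counterpart for \<open>commutation\<close>. Unlike the
  outer coefficients, it vanishes only after adding the returns from above and from below.\<close>

lemma return_linear:
  "up k * (1 - up (k + 1)) * (2 * pt k - (r + 1 / r) * pt (k + 1)) +
   (1 - up k) * up (k - 1) * (2 * pt k - (r + 1 / r) * pt (k - 1)) = 0" (is "?A * ?a + ?B * ?b = 0")
proof (rule return_identity)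
  let ?s = width
  have "?s * (?a * (r\<^sup>2 + (r powi k)\<^sup>2) + ?b * (1 + (r powi k)\<^sup>2 * r\<^sup>2)) =
     (2 * (?s * pt k) - (r + 1 / r) * (?s * pt (k + 1))) * (r\<^sup>2 + (r powi k)\<^sup>2) +
     (2 * (?s * pt k) - (r + 1 / r) * (?s * pt (k - 1))) * (1 + (r powi k)\<^sup>2 * r\<^sup>2)"
    by (simp add: algebra_simps)
  also have "\<dots> = 0"
    unfolding pt_eq[of k] using r_pos powi_pos[of k] by (simp add: field_simps power2_eq_square)
  finally show "?a * (r\<^sup>2 + (r powi k)\<^sup>2) + ?b * (1 + (r powi k)\<^sup>2 * r\<^sup>2) = 0"
    using width_pos by (metis mult_eq_0_iff less_irrefl)
qed

lemma return_quadratic: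
  "up k * (1 - up (k + 1)) * ((pt (k + 1))\<^sup>2 - (pt k)\<^sup>2 - (1 - 1 / r\<^sup>2)) +
   (1 - up k) * up (k - 1) * ((pt (k - 1))\<^sup>2 - (pt k)\<^sup>2 - (1 - 1 / r\<^sup>2)) = 0" (is "?A * ?a + ?B * ?b = 0")
proof (rule return_identity)
  let ?s = width
  have "?s\<^sup>2 * (?a * (r\<^sup>2 + (r powi k)\<^sup>2) + ?b * (1 + (r powi k)\<^sup>2 * r\<^sup>2)) =
     ((?s * pt (k + 1))\<^sup>2 - (?s * pt k)\<^sup>2 - ?s\<^sup>2 * (1 - 1 / r\<^sup>2)) * (r\<^sup>2 + (r powi k)\<^sup>2) +
     ((?s * pt (k - 1))\<^sup>2 - (?s * pt k)\<^sup>2 - ?s\<^sup>2 * (1 - 1 / r\<^sup>2)) * (1 + (r powi k)\<^sup>2 * r\<^sup>2)"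
    by (simp only: algebra_simps power_mult_distrib)
  also have "\<dots> = 0"
    unfolding pt_eq[of k] width_sq using r_pos powi_pos[of k] by (simp add: field_simps power2_eq_square)
  finally show "?a * (r\<^sup>2 + (r powi k)\<^sup>2) + ?b * (1 + (r powi k)\<^sup>2 * r\<^sup>2) = 0"
    using width_pos by (metis mult_eq_0_iff less_irrefl power_not_zero)
qed

text \<open>Two steps from \<open>k\<close> lead to \<open>k + 2\<close>, \<open>k - 2\<close> or
  \<open>k\<close>, so each relation splits into three coefficients of \<open>g\<close>. The outer
  ones vanish by \<open>pt_linear\<close> and \<open>pt_quadratic\<close>, the middle one by the
  return identities.\<close>

sublocale q_oscillator step pt r
proof
  show "1 < r" by (rule r_gt_1)
  show "step (\<lambda>x. a * g x + b * h x) = (\<lambda>x. a * step g x + b * step h x)" for a b g h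
    by (simp add: step_def fun_eq_iff algebra_simps)
next
  fix g k
  have "step (step (\<lambda>x. pt x * g x)) k + pt k * step (step g) k
      - (r + 1 / r) * step (\<lambda>y. pt y * step g y) k =
    up k * up (k + 1) * g (k + 2) * (pt (k + 2) + pt k - (r + 1 / r) * pt (k + 1)) +
    (1 - up k) * (1 - up (k - 1)) * g (k - 2) * (pt k + pt (k - 2) - (r + 1 / r) * pt (k - 1)) +
    g k * (up k * (1 - up (k + 1)) * (2 * pt k - (r + 1 / r) * pt (k + 1)) +
   (1 - up k) * up (k - 1) * (2 * pt k - (r + 1 / r) * pt (k - 1)))"
    by (simp add: step_def) (simp add: algebra_simps add_divide_distrib diff_divide_distrib)
  also have "\<dots> = 0"
    using pt_linear[of "k + 1"] pt_linear[of "k - 1"] unfolding return_linear by (simp add: add_ac)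
  finally show "step (step (\<lambda>x. pt x * g x)) k + pt k * step (step g) k =
      (r + 1 / r) * step (\<lambda>y. pt y * step g y) k" by simp
next
  fix g k
  have "step (\<lambda>y. pt y * (pt y * step g y)) k - pt k * step (step (\<lambda>y. pt y * g y)) k
      - (1 - 1 / r\<^sup>2) * step (step g) k =
    up k * up (k + 1) * g (k + 2) * ((pt (k + 1))\<^sup>2 - (pt k * pt (k + 2) + (1 - 1 / r\<^sup>2))) +
    (1 - up k) * (1 - up (k - 1)) * g (k - 2) * ((pt (k - 1))\<^sup>2 - (pt (k - 2) * pt k + (1 - 1 / r\<^sup>2))) +
    g k * (up k * (1 - up (k + 1)) * ((pt (k + 1))\<^sup>2 - (pt k)\<^sup>2 - (1 - 1 / r\<^sup>2)) +
   (1 - up k) * up (k - 1) * ((pt (k - 1))\<^sup>2 - (pt k)\<^sup>2 - (1 - 1 / r\<^sup>2)))"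
    by (simp add: step_def) (simp add: algebra_simps add_divide_distrib diff_divide_distrib power2_eq_square)
  also have "\<dots> = 0"
    using pt_quadratic[of "k + 1"] pt_quadratic[of "k - 1"] unfolding return_quadratic by (simp add: add_ac)
  finally show "step (\<lambda>y. pt y * (pt y * step g y)) k - pt k * step (step (\<lambda>y. pt y * g y)) k =
      (1 - 1 / r\<^sup>2) * step (step g) k" by simp
qed

lemma funpow_step_pt: "(step ^^ n) pt = (\<lambda>k. pt k / r ^ n)"
proof (induction n)
  case (Suc n)
  have "(step ^^ Suc n) pt = step (\<lambda>k. pt k / r ^ n)" using Suc by simp
  then show ?case by (simp add: T_simps step_pt fun_eq_iff)
qed simp

lemma step_const: "step (\<lambda>_. a) = (\<lambda>_. a)"
  by (simp add: step_def fun_eq_iff algebra_simps)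

lemma funpow_step_pt_sq:
  "(step ^^ n) (\<lambda>k. (pt k)\<^sup>2) = (\<lambda>k. (pt k)\<^sup>2 / (r ^ n)\<^sup>2 + (1 - 1 / (r ^ n)\<^sup>2))"
proof (induction n)
  case (Suc n)
  have "(step ^^ Suc n) (\<lambda>k. (pt k)\<^sup>2) = step (\<lambda>k. (pt k)\<^sup>2 / (r ^ n)\<^sup>2 + (1 - 1 / (r ^ n)\<^sup>2))"
    using Suc by simp
  also have "\<dots> = (\<lambda>k. (pt k)\<^sup>2 / (r ^ Suc n)\<^sup>2 + (1 - 1 / (r ^ Suc n)\<^sup>2))"
    using r_pos by (simp add: T_simps step_const step_pt_sq fun_eq_iff field_simps)
  finally show ?case .
qed simp

section \<open>Transition kernels and their expectations\<close>

fun kernel :: "nat \<Rightarrow> int \<Rightarrow> int pmf" where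
  "kernel 0 i = return_pmf i"
| "kernel (Suc n) i = bind_pmf (bernoulli_pmf (up i)) (\<lambda>b. kernel n (if b then i + 1 else i - 1))"

text \<open>Finite support makes every real function integrable under the kernel.\<close>

lemma finite_set_kernel: "finite (set_pmf (kernel n i))"
  by (induction n arbitrary: i) auto

lemma expectation_kernel: "measure_pmf.expectation (kernel n i) g = (step ^^ n) g i"
proof (induction n arbitrary: i)
  case (Suc n)
  have "measure_pmf.expectation (kernel (Suc n) i) g =
      (\<Sum>b\<in>UNIV. pmf (bernoulli_pmf (up i)) b *\<^sub>R measure_pmf.expectation (kernel n (if b then i + 1 else i - 1)) g)"
    unfolding kernel.simps
    by (rule pmf_expectation_bind) (auto simp: finite_set_kernel)
  also have "\<dots> = (step ^^ Suc n) g i"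
    using up_bounds[of i] by (simp add: UNIV_bool Suc step_def[of "(step ^^ n) g"])
  finally show ?case .
qed simp

lemma pmf_kernel: "pmf (kernel n i) j = (step ^^ n) (indicator {j}) i"
  by (simp add: expectation_kernel[symmetric] pmf.rep_eq)

section \<open>Edge weights and the stationary law\<close>

definition weight :: "int \<Rightarrow> real" where
  "weight k = r powi (- (k * (k + 1)))"

definition total :: real where
  "total = (\<integral>k. weight k \<partial>count_space UNIV)"

lemma weight_pos: "0 < weight k"
  by (simp add: weight_def powi_pos)

lemma weight_pred: "weight (k - 1) = weight k * (r powi k)\<^sup>2"
proof -
  have *: "- ((k - 1) * (k - 1 + 1)) = - (k * (k + 1)) + (k + k)" by (simp add: algebra_simps)
  have "r powi (i + j) = r powi i * r powi j" for i j :: int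
    using r_pos by (intro power_int_add) simp
  then show ?thesis
    unfolding weight_def * power2_eq_square by presburger
qed

lemma weight_uminus: "weight (- k) = weight (k - 1)"
  by (simp add: weight_def algebra_simps)

lemma integrable_weight: "integrable (count_space UNIV) weight"
proof -
  have "Infinite_Set_Sum.abs_summable_on weight (range int)"
  proof -
    have "norm (weight (int n)) \<le> (1 / r) ^ n" for n
    proof -
      have "int n * (int n + 1) = int (n * (n + 1))" by (simp add: algebra_simps)
      then have "weight (int n) = (1 / r) ^ (n * (n + 1))"
        unfolding weight_def by (simp only: power_int_minus power_int_of_nat) (simp add: power_one_over inverse_eq_divide)
      also have "\<dots> \<le> (1 / r) ^ n"
        using r_gt_1 by (intro power_decreasing) auto
      finally show ?thesis using weight_pos[of "int n"] by simp
    qed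
    moreover have "summable (\<lambda>n. (1 / r) ^ n)"
      using r_gt_1 by (intro summable_geometric) simp
    ultimately have "summable (\<lambda>n. norm (weight (int n)))"
      using summable_comparison_test'[of "\<lambda>n. (1 / r) ^ n" 0 "\<lambda>n. norm (weight (int n))"]
      by simp
    then have "Infinite_Set_Sum.abs_summable_on (\<lambda>n. weight (int n)) UNIV"
      by (simp add: Infinite_Set_Sum.abs_summable_on_nat_iff')
    then show ?thesis
      by (subst (asm) Infinite_Set_Sum.abs_summable_on_reindex_iff) auto
  qed
  \<comment> \<open>The reflection of \<open>k\<close> to \<open>- 1 - k\<close> preserves
    \<open>weight\<close> and exchanges the two halves of the integers.\<close>
  moreover have "Infinite_Set_Sum.abs_summable_on weight (range (\<lambda>n. - 1 - int n))"
  proof -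
    have "Infinite_Set_Sum.abs_summable_on (\<lambda>n. weight (int n)) UNIV"
      using calculation by (subst Infinite_Set_Sum.abs_summable_on_reindex_iff) auto
    moreover have "weight (- 1 - int n) = weight (int n)" for n
      by (simp add: weight_def algebra_simps)
    ultimately have "Infinite_Set_Sum.abs_summable_on (\<lambda>n. weight (- 1 - int n)) UNIV" by simp
    then show ?thesis
      by (subst (asm) Infinite_Set_Sum.abs_summable_on_reindex_iff) (auto simp: inj_on_def)
  qed
  ultimately have "Infinite_Set_Sum.abs_summable_on weight (range int \<union> range (\<lambda>n. - 1 - int n))"
    by (rule Infinite_Set_Sum.abs_summable_on_union)
  also have "range int \<union> range (\<lambda>n. - 1 - int n) = UNIV"
  proof -
    have "k \<in> range int \<union> range (\<lambda>n. - 1 - int n)" for k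
    proof (cases "k \<ge> 0")
      case True then have "k = int (nat k)" by simp then show ?thesis by blast
    next
      case False then have "k = - 1 - int (nat (- k - 1))" by simp then show ?thesis by blast
    qed
    then show ?thesis by auto
  qed
  finally show ?thesis by (simp add: Infinite_Set_Sum.abs_summable_on_def)
qed

text \<open>Translation invariance of the counting measure. The normalisation and the second moment
  of \<open>stat\<close> reduce to it by writing the summand as a combination of translates of
  \<open>weight\<close>.\<close>

lemma has_integral_weight: "has_bochner_integral (count_space UNIV) (\<lambda>k. weight (k + a)) total"
proof -
  have "bij (\<lambda>k. k + a)" by (rule bijI) (auto simp: inj_def intro!: surjI[of _ "\<lambda>k. k - a"])
  then show ?thesis
    using integrable_bij_count_space[of "\<lambda>k. k + a" UNIV UNIV weight]
      integral_bij_count_space[of "\<lambda>k. k + a" UNIV UNIV weight] integrable_weight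
    by (simp add: has_bochner_integral_iff total_def)
qed

lemma total_pos: "0 < total"
proof -
  have "total \<noteq> 0"
  proof
    assume "total = 0"
    then have "AE k in count_space UNIV. weight k = 0"
      unfolding total_def using integrable_weight weight_pos
      by (subst (asm) integral_nonneg_eq_0_iff_AE) (auto intro: less_imp_le)
    then show False using weight_pos[of 0] by (simp add: AE_count_space)
  qed
  moreover have "0 \<le> total"
    unfolding total_def by (rule Bochner_Integration.integral_nonneg) (simp add: less_imp_le weight_pos)
  ultimately show ?thesis by simp
qed

definition stat :: "int pmf" where
  "stat = embed_pmf (\<lambda>k. (weight k + weight (k - 1)) / (2 * total))"

lemma pmf_stat: "pmf stat k = (weight k + weight (k - 1)) / (2 * total)"
  unfolding stat_def
proof (rule pmf_embed_pmf)
  show nn: "0 \<le> (weight k + weight (k - 1)) / (2 * total)" for k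
    using weight_pos[of k] weight_pos[of "k - 1"] total_pos by simp
  have "has_bochner_integral (count_space UNIV) (\<lambda>k. (weight (k + 0) + weight (k + - 1)) / (2 * total)) ((total + total) / (2 * total))"
    by (intro has_bochner_integral_divide_zero has_bochner_integral_add has_integral_weight)
  then have i: "has_bochner_integral (count_space UNIV) (\<lambda>k. (weight k + weight (k - 1)) / (2 * total)) 1"
    using total_pos by simp
  show "(\<integral>\<^sup>+k. ennreal ((weight k + weight (k - 1)) / (2 * total)) \<partial>count_space UNIV) = 1"
    using i nn by (subst nn_integral_eq_integral) (auto simp: has_bochner_integral_iff)
qed

lemma integral_stat:
  assumes "has_bochner_integral (count_space UNIV) (\<lambda>k. (weight k + weight (k - 1)) * g k) (2 * total * a)"
  shows "has_bochner_integral stat g a"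
proof -
  have "has_bochner_integral (count_space UNIV) (\<lambda>k. pmf stat k *\<^sub>R g k) a"
    using has_bochner_integral_divide_zero[OF assms, of "2 * total"] total_pos by (simp add: pmf_stat)
  then show ?thesis
    unfolding measure_pmf_eq_density by (subst has_bochner_integral_density) auto
qed

lemma stat_second_moment: "has_bochner_integral stat (\<lambda>k. (pt k)\<^sup>2) 1"
proof (rule integral_stat)
  \<comment> \<open>Up to a power of \<open>r\<close>, multiplying by
    \<open>(r powi k)\<^sup>2\<close> or its inverse moves the index of \<open>weight\<close> by
    one, so expanding the square of \<open>pt k\<close> leaves only translates. The offsets are
    written in the form \<open>k + a\<close> to match \<open>has_integral_weight\<close>.\<close>
  have *: "(weight k + weight (k - 1)) * (pt k)\<^sup>2 =
      (r\<^sup>2 * (weight (k + - 2) + weight (k + 1)) - weight (k + 0) - weight (k + - 1)) / (r\<^sup>2 - 1)" for k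
  proof -
    define u where "u = r powi k"
    have u: "u > 0" unfolding u_def by (rule powi_pos)
    have 1: "weight (k - 1) = weight k * u\<^sup>2"
      using weight_pred[of k] by (simp add: u_def)
    have 2: "weight k = weight (k + 1) * (u * r)\<^sup>2"
      using weight_pred[of "k + 1"] by (simp add: u_def powi_succ)
    have 3: "weight (k - 2) = weight (k - 1) * (u / r)\<^sup>2"
      using weight_pred[of "k - 1"] by (simp add: u_def powi_pred)
    have "(pt k)\<^sup>2 = (u - 1 / u)\<^sup>2 / (r\<^sup>2 - 1)"
      by (simp add: pt_def u_def power_divide width_sq)
    then show ?thesis
      using u r_pos by (simp add: 3) (simp add: 1, simp add: 2 field_simps power2_eq_square)
  qed
  have "has_bochner_integral (count_space UNIV) (\<lambda>k. (weight k + weight (k - 1)) * (pt k)\<^sup>2)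
      ((r\<^sup>2 * (total + total) - total - total) / (r\<^sup>2 - 1))"
    unfolding *
    by (intro has_bochner_integral_divide_zero has_bochner_integral_diff
        has_bochner_integral_mult_right has_bochner_integral_add has_integral_weight)
  also have "(r\<^sup>2 * (total + total) - total - total) / (r\<^sup>2 - 1) = 2 * total * 1"
    using r_square_gt_1 by (simp add: field_simps)
  finally show "has_bochner_integral (count_space UNIV) (\<lambda>k. (weight k + weight (k - 1)) * (pt k)\<^sup>2)
      (2 * total * 1)" .
qed

lemma stat_uminus: "map_pmf uminus stat = stat"
proof (rule pmf_eqI)
  fix k
  have "pmf (map_pmf uminus stat) (- (- k)) = pmf stat (- k)"
    by (rule pmf_map_inj') (auto simp: inj_def)
  also have "\<dots> = pmf stat k"
    using weight_uminus[of k] weight_uminus[of "k + 1"] by (simp add: pmf_stat)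
  finally show "pmf (map_pmf uminus stat) k = pmf stat k" by simp
qed

lemma pt_uminus: "pt (- k) = - pt k"
  by (simp add: pt_def power_int_minus minus_divide_left inverse_eq_divide)

text \<open>Since \<open>stat\<close> is symmetric and \<open>pt\<close> is odd, the expectation
  equals its own negative.\<close>

lemma stat_mean: "measure_pmf.expectation stat pt = 0"
proof -
  have "measure_pmf.expectation stat pt = measure_pmf.expectation (map_pmf uminus stat) pt"
    by (simp add: stat_uminus)
  also have "\<dots> = - measure_pmf.expectation stat pt"
    by (simp add: pt_uminus)
  finally show ?thesis by simp
qed

text \<open>Both sides equal \<open>weight k / (2 * total)\<close>: \<open>weight k\<close> is the
  conductance of the edge between \<open>k\<close> and \<open>k + 1\<close>.\<close>

lemma stat_step_reversible: "pmf stat k * up k = pmf stat (k + 1) * (1 - up (k + 1))"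
proof -
  have n: "1 + (r powi k)\<^sup>2 > 0" for k by (simp add: add_pos_nonneg)
  have s: "pmf stat k = weight k * (1 + (r powi k)\<^sup>2) / (2 * total)" for k
    by (simp add: pmf_stat weight_pred algebra_simps)
  have d: "1 - up k = (r powi k)\<^sup>2 / (1 + (r powi k)\<^sup>2)" for k
    using n[of k] by (simp add: up_def field_simps)
  have "pmf stat k * up k = weight k / (2 * total)" for k
    using n[of k] by (simp add: s up_def)
  moreover have "pmf stat k * (1 - up k) = weight (k - 1) / (2 * total)" for k
    using n[of k] by (simp add: s d weight_pred)
  ultimately show ?thesis by simp
qed

lemma step_indicator:
  "step (indicator {j}) = (\<lambda>k. up (j - 1) * indicator {j - 1} k + (1 - up (j + 1)) * indicator {j + 1} k)"
  by (auto simp: step_def fun_eq_iff indicator_def)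

text \<open>The induction peels the last step off the path from \<open>i\<close> to \<open>j\<close>
  and turns it into the first step from \<open>j\<close>, using detailed balance for a single
  step.\<close>

lemma kernel_reversible: "pmf stat i * pmf (kernel n i) j = pmf stat j * pmf (kernel n j) i"
proof (induction n arbitrary: i j)
  case 0
  then show ?case by (auto simp: indicator_def)
next
  case (Suc n)
  have "pmf stat i * pmf (kernel (Suc n) i) j = pmf stat i * (step ^^ n) (step (indicator {j})) i"
    by (simp only: pmf_kernel funpow.simps o_apply funpow_swap)
  also have "\<dots> = up (j - 1) * (pmf stat i * pmf (kernel n i) (j - 1)) +
      (1 - up (j + 1)) * (pmf stat i * pmf (kernel n i) (j + 1))"
    unfolding step_indicator linopD[OF linop_funpow[OF linop_T]]
    by (simp add: pmf_kernel algebra_simps)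
  also have "\<dots> = pmf stat (j - 1) * up (j - 1) * pmf (kernel n (j - 1)) i +
      pmf stat (j + 1) * (1 - up (j + 1)) * pmf (kernel n (j + 1)) i"
    unfolding Suc[of i] by (simp add: mult_ac)
  also have "\<dots> = pmf stat j * step (\<lambda>k. pmf (kernel n k) i) j"
  proof -
    have "pmf stat (j - 1) * up (j - 1) = pmf stat j * (1 - up j)"
      using stat_step_reversible[of "j - 1"] by simp
    then show ?thesis
      unfolding stat_step_reversible[of j, symmetric] step_def by (simp add: distrib_left)
  qed
  also have "\<dots> = pmf stat j * pmf (kernel (Suc n) j) i"
    by (simp only: pmf_kernel funpow.simps o_apply)
  finally show ?case .
qed

end

section \<open>Stationary two-sided chains\<close>

text \<open>\<open>J n\<close> is a window of times on which an event prescribes the whole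
  configuration. The empty set is added so that incompatible prescriptions still intersect inside
  the system.\<close>

definition cylinders :: "'b set \<Rightarrow> (int \<Rightarrow> 'b \<Rightarrow> 's) \<Rightarrow> (nat \<Rightarrow> int set) \<Rightarrow> 'b set set" where
  "cylinders \<Omega> Y J = insert {} {{\<omega> \<in> \<Omega>. \<forall>j\<in>J n. Y j \<omega> = i j} | n i. True}"

lemma cylinder_in_cylinders: "{\<omega> \<in> \<Omega>. \<forall>j\<in>J n. Y j \<omega> = i j} \<in> cylinders \<Omega> Y J"
  unfolding cylinders_def by blast

text \<open>For nested windows, two prescriptions either agree on the smaller window, and the finer
  cylinder is the intersection, or they contradict each other.\<close>

lemma Int_stable_cylinders:
  assumes "mono J"
  shows "Int_stable (cylinders \<Omega> Y J)"
proof -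
  have *: "{\<omega> \<in> \<Omega>. \<forall>j\<in>J n. Y j \<omega> = i j} \<inter> {\<omega> \<in> \<Omega>. \<forall>j\<in>J m. Y j \<omega> = l j} \<in> cylinders \<Omega> Y J"
    if "n \<le> m" for n m i l
  proof -
    have J: "J n \<subseteq> J m" using assms that by (rule monoD)
    show ?thesis
    proof (cases "\<forall>j\<in>J n. i j = l j")
      case True
      then have "{\<omega> \<in> \<Omega>. \<forall>j\<in>J n. Y j \<omega> = i j} \<inter> {\<omega> \<in> \<Omega>. \<forall>j\<in>J m. Y j \<omega> = l j} =
          {\<omega> \<in> \<Omega>. \<forall>j\<in>J m. Y j \<omega> = l j}"
        using J by auto
      then show ?thesis unfolding cylinders_def by blast
    next
      case False
      then have "{\<omega> \<in> \<Omega>. \<forall>j\<in>J n. Y j \<omega> = i j} \<inter> {\<omega> \<in> \<Omega>. \<forall>j\<in>J m. Y j \<omega> = l j} = {}"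
        using J by fastforce
      then show ?thesis unfolding cylinders_def by blast
    qed
  qed
  show ?thesis
  proof (rule Int_stableI)
    fix A B assume AB: "A \<in> cylinders \<Omega> Y J" "B \<in> cylinders \<Omega> Y J"
    show "A \<inter> B \<in> cylinders \<Omega> Y J"
    proof (cases "A = {} \<or> B = {}")
      case True then show ?thesis by (auto simp: cylinders_def)
    next
      case False
      then obtain n m i l where A: "A = {\<omega> \<in> \<Omega>. \<forall>j\<in>J n. Y j \<omega> = i j}"
        and B: "B = {\<omega> \<in> \<Omega>. \<forall>j\<in>J m. Y j \<omega> = l j}"
        using AB by (auto simp: cylinders_def)
      show ?thesis
      proof (cases "n \<le> m")
        case True then show ?thesis unfolding A B by (rule *)
      next
        case False then show ?thesis unfolding A B by (subst Int_commute, intro *) simp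
      qed
    qed
  qed
qed

text \<open>A finite window has only countably many configurations, and these are numbered; a number
  that is not attained gives the empty set. Uniqueness arguments on generators ask for such an
  exhaustion.\<close>

lemma cylinders_partition:
  fixes Y :: "int \<Rightarrow> 'b \<Rightarrow> 's::countable"
  assumes "finite (J n)"
  obtains A :: "nat \<Rightarrow> 'b set"
  where "range A \<subseteq> cylinders \<Omega> Y J" "disjoint_family A" "(\<Union>m. A m) = \<Omega>"
proof
  define I where "I = J n \<rightarrow>\<^sub>E (UNIV :: 's set)"
  have I: "countable I" unfolding I_def using assms by (intro countable_PiE) auto
  define A where "A m = {\<omega> \<in> \<Omega>. to_nat_on I (\<lambda>j\<in>J n. Y j \<omega>) = m}" for m
  show "disjoint_family A" "(\<Union>m. A m) = \<Omega>"
    by (auto simp: disjoint_family_on_def A_def)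
  show "range A \<subseteq> cylinders \<Omega> Y J"
  proof (rule image_subsetI)
    fix m
    show "A m \<in> cylinders \<Omega> Y J"
    proof (cases "A m = {}")
      case False
      then obtain \<omega>0 where \<omega>0: "\<omega>0 \<in> \<Omega>" "to_nat_on I (\<lambda>j\<in>J n. Y j \<omega>0) = m" by (auto simp: A_def)
      have "to_nat_on I (\<lambda>j\<in>J n. Y j \<omega>) = m \<longleftrightarrow> (\<forall>j\<in>J n. Y j \<omega> = Y j \<omega>0)" for \<omega>
      proof -
        have "to_nat_on I (\<lambda>j\<in>J n. Y j \<omega>) = m \<longleftrightarrow> (\<lambda>j\<in>J n. Y j \<omega>) = (\<lambda>j\<in>J n. Y j \<omega>0)"
          unfolding \<omega>0(2)[symmetric] by (subst to_nat_on_inj[OF I]) (auto simp: I_def)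
        then show ?thesis by (auto simp: fun_eq_iff restrict_def)
      qed
      then have "A m = {\<omega> \<in> \<Omega>. \<forall>j\<in>J n. Y j \<omega> = Y j \<omega>0}" by (simp add: A_def)
      then show ?thesis using cylinder_in_cylinders[of \<Omega> J n Y "\<lambda>j. Y j \<omega>0"] by simp
    qed (simp add: cylinders_def)
  qed
qed

lemma coordinate_in_sigma_cylinders:
  fixes Y :: "int \<Rightarrow> 'b \<Rightarrow> 's::countable"
  assumes "finite (J n)" "j \<in> J n"
  shows "{\<omega> \<in> \<Omega>. Y j \<omega> \<in> S} \<in> sigma_sets \<Omega> (cylinders \<Omega> Y J)"
proof -
  define I where "I = {i \<in> J n \<rightarrow>\<^sub>E (UNIV :: 's set). i j \<in> S}"
  have "countable (J n \<rightarrow>\<^sub>E (UNIV :: 's set))" using assms by (intro countable_PiE) auto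
  then have I: "countable I" unfolding I_def by (rule countable_subset[rotated]) auto
  have "{\<omega> \<in> \<Omega>. Y j \<omega> \<in> S} = (\<Union>i\<in>I. {\<omega> \<in> \<Omega>. \<forall>l\<in>J n. Y l \<omega> = i l})"
  proof safe
    fix \<omega> assume "\<omega> \<in> \<Omega>" "Y j \<omega> \<in> S"
    then show "\<omega> \<in> (\<Union>i\<in>I. {\<omega> \<in> \<Omega>. \<forall>l\<in>J n. Y l \<omega> = i l})"
      using assms by (intro UN_I[of "\<lambda>l\<in>J n. Y l \<omega>"]) (auto simp: I_def)
  qed (use assms in \<open>auto simp: I_def\<close>)
  also have "\<dots> \<in> sigma_sets \<Omega> (cylinders \<Omega> Y J)"
    using I by (intro sigma_sets_UNION) (auto simp: cylinders_def intro!: sigma_sets.Basic)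
  finally show ?thesis .
qed

text \<open>Dynkin's argument, for set integrals in place of measures. The partition supplies the
  identity on the whole space, on which the complement step relies.\<close>

lemma set_integral_eq_generator:
  fixes f g :: "'b \<Rightarrow> real"
  assumes f: "integrable M f" and g: "integrable M g"
    and E: "Int_stable E" "E \<subseteq> sets M"
    and eq: "\<And>A. A \<in> E \<Longrightarrow> (LINT x:A|M. f x) = (LINT x:A|M. g x)"
    and A: "range A \<subseteq> E" "disjoint_family A" "(\<Union>n::nat. A n) = space M"
    and B: "B \<in> sigma_sets (space M) E"
  shows "(LINT x:B|M. f x) = (LINT x:B|M. g x)"
proof -
  have sub: "sigma_sets (space M) E \<subseteq> sets M"
    using E(2) by (rule sets.sigma_sets_subset)
  have int: "set_integrable M C f" "set_integrable M C g" if "C \<in> sets M" for C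
    using integrable_mult_indicator[OF that f] integrable_mult_indicator[OF that g]
    by (simp_all add: set_integrable_def)
  have countable_union: "(LINT x:(\<Union>i. F i)|M. f x) = (LINT x:(\<Union>i. F i)|M. g x)"
    if F: "disjoint_family F" "range F \<subseteq> sets M" "\<And>i::nat. (LINT x:F i|M. f x) = (LINT x:F i|M. g x)" for F
    using F by (subst (1 2) lebesgue_integral_countable_add)
      (auto simp: disjoint_family_on_def intro!: int)
  have whole: "(LINT x:space M|M. f x) = (LINT x:space M|M. g x)"
  proof -
    have "A n \<in> E" for n using A(1) by auto
    then show ?thesis using countable_union[OF A(2)] E(2) eq by (auto simp: A(3))
  qed
  have "E \<subseteq> Pow (space M)" using E(2) sets.sets_into_space by blast
  from E(1) this B show ?thesis
  proof (induction rule: sigma_sets_induct_disjoint)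
    case (basic A) then show ?case by (rule eq)
  next
    case empty show ?case by (simp add: set_lebesgue_integral_def)
  next
    case (compl C)
    have C: "C \<in> sets M" using compl(1) sub by blast
    have split: "(LINT x:space M|M. h x) = (LINT x:C|M. h x) + (LINT x:space M - C|M. h x)"
      if "set_integrable M C h" "set_integrable M (space M - C) h" for h :: "'b \<Rightarrow> real"
      using set_integral_Un[OF _ that] sets.sets_into_space[OF C] by (auto simp: Un_absorb1)
    show ?case
      using split[of f] split[of g] int[OF C] int[of "space M - C"] C whole compl(2) by simp
  next
    case (union F)
    then show ?case using sub by (intro countable_union) auto
  qed
qed

text \<open>The windows contain time 0, from which the chain is built below in both directions. The
  product formula itself does not single out that time, and this is the source of
  stationarity.\<close>

locale two_sided_chain = prob_space M
  for M :: "'b measure" and Y :: "int \<Rightarrow> 'b \<Rightarrow> 's::countable"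
    and init :: "'s pmf" and K :: "'s \<Rightarrow> 's pmf" +
  assumes measurable_Y [measurable]: "Y k \<in> measurable M (count_space UNIV)"
    and prob_cylinder: "a \<le> 0 \<Longrightarrow> 0 \<le> b \<Longrightarrow> prob {\<omega> \<in> space M. \<forall>j\<in>{a..b}. Y j \<omega> = i j} =
      pmf init (i a) * (\<Prod>j\<in>{a..<b}. pmf (K (i j)) (i (j + 1)))"
begin

abbreviation paths :: "(int \<Rightarrow> 's) measure" where
  "paths \<equiv> Pi\<^sub>M UNIV (\<lambda>_. count_space UNIV)"

lemma measurable_path: "(\<lambda>\<omega> k. Y (k + h) \<omega>) \<in> measurable M paths"
  by (intro measurable_PiM_single') auto

lemma prob_cylinder_shift:
  assumes "a \<le> - h" "- h \<le> b"
  shows "prob {\<omega> \<in> space M. \<forall>j\<in>{a..b}. Y (j + h) \<omega> = i j} =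
      pmf init (i a) * (\<Prod>j\<in>{a..<b}. pmf (K (i j)) (i (j + 1)))"
proof -
  have "{\<omega> \<in> space M. \<forall>j\<in>{a..b}. Y (j + h) \<omega> = i j} =
      {\<omega> \<in> space M. \<forall>j\<in>{a + h..b + h}. Y j \<omega> = i (j - h)}"
  proof -
    have "(\<forall>j\<in>{a..b}. P (j + h) (i j)) \<longleftrightarrow> (\<forall>j\<in>{a + h..b + h}. P j (i (j - h)))" for P
    proof safe
      fix j assume *: "\<forall>j\<in>{a..b}. P (j + h) (i j)" and "j \<in> {a + h..b + h}"
      then have "j - h \<in> {a..b}" by auto
      with * have "P (j - h + h) (i (j - h))" by blast
      then show "P j (i (j - h))" by simp
    next
      fix j assume *: "\<forall>j\<in>{a + h..b + h}. P j (i (j - h))" and "j \<in> {a..b}"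
      then have "j + h \<in> {a + h..b + h}" by auto
      with * have "P (j + h) (i (j + h - h))" by blast
      then show "P (j + h) (i j)" by simp
    qed
    from this[of "\<lambda>j s. Y j _ = s"] show ?thesis by simp
  qed
  moreover have "(\<Prod>j\<in>{a + h..<b + h}. pmf (K (i (j - h))) (i (j + 1 - h))) =
      (\<Prod>j\<in>{a..<b}. pmf (K (i j)) (i (j + 1)))"
    by (rule prod.reindex_bij_witness[of _ "\<lambda>j. j + h" "\<lambda>j. j - h"]) (auto simp: algebra_simps)
  ultimately show ?thesis
    using assms prob_cylinder[of "a + h" "b + h" "\<lambda>j. i (j - h)"] by simp
qed

lemma stationary: "distr M paths (\<lambda>\<omega> k. Y (k + h) \<omega>) = distr M paths (\<lambda>\<omega> k. Y k \<omega>)"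
proof -
  \<comment> \<open>The margin \<open>\<bar>h\<bar>\<close> puts both \<open>0\<close> and
    \<open>- h\<close> into every window, so \<open>prob_cylinder_shift\<close> applies to the
    process and to its shift with the same window.\<close>
  define J :: "nat \<Rightarrow> int set" where "J n = {- (int n + \<bar>h\<bar>)..int n + \<bar>h\<bar>}" for n
  define E where "E = cylinders (UNIV :: (int \<Rightarrow> 's) set) (\<lambda>j y. y j) J"
  have J: "mono J" "finite (J n)" for n by (auto simp: J_def mono_def)
  obtain A where A: "range A \<subseteq> E" "disjoint_family A" "(\<Union>n::nat. A n) = UNIV"
    using cylinders_partition[where J = J and n = 0 and \<Omega> = UNIV and Y = "\<lambda>j y. y j"] J(2)[of 0] unfolding E_def by metis
  interpret S: prob_space "distr M paths (\<lambda>\<omega> k. Y (k + h) \<omega>)"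
    by (rule prob_space_distr[OF measurable_path])
  have sets: "sets paths = sigma_sets UNIV E"
  proof
    have "E \<subseteq> sets paths"
    proof
      fix B assume "B \<in> E"
      then have "B = {} \<or> (\<exists>n i. B = {y \<in> space paths. \<forall>j\<in>J n. y j = i j})"
        by (auto simp: E_def cylinders_def space_PiM)
      moreover have "{y \<in> space paths. \<forall>j\<in>J n. y j = i j} \<in> sets paths" for n i
        using J(2)[of n] by measurable
      ultimately show "B \<in> sets paths" by auto
    qed
    then show "sigma_sets UNIV E \<subseteq> sets paths"
      using sets.sigma_sets_subset[of E paths] by (simp add: space_PiM)
    have "j \<in> J (nat \<bar>j\<bar>)" for j by (auto simp: J_def)
    then have *: "{y. y j \<in> S} \<in> sigma_sets UNIV E" for j S
      using coordinate_in_sigma_cylinders[of J "nat \<bar>j\<bar>", OF J(2), where j = j and \<Omega> = UNIV and Y = "\<lambda>j y. y j" and S = S] by (simp add: E_def)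
    have "sets paths = sigma_sets UNIV {{y. y j \<in> S} |j S. True}"
      by (simp add: sets_PiM_single PiE_UNIV_domain)
    also have "\<dots> \<subseteq> sigma_sets UNIV E"
      by (rule sigma_sets_mono) (use * in auto)
    finally show "sets paths \<subseteq> sigma_sets UNIV E" .
  qed
  have em: "emeasure (distr M paths (\<lambda>\<omega> k. Y (k + g) \<omega>)) {y. \<forall>j\<in>J n. y j = i j} =
      pmf init (i (- (int n + \<bar>h\<bar>))) * (\<Prod>j\<in>{- (int n + \<bar>h\<bar>)..<int n + \<bar>h\<bar>}. pmf (K (i j)) (i (j + 1)))"
    if "g = h \<or> g = 0" for n i g
  proof -
    have "{y. \<forall>j\<in>J n. y j = i j} \<in> sets paths"
      unfolding sets E_def cylinders_def by (intro sigma_sets.Basic) auto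
    then have "emeasure (distr M paths (\<lambda>\<omega> k. Y (k + g) \<omega>)) {y. \<forall>j\<in>J n. y j = i j} =
        emeasure M ((\<lambda>\<omega> k. Y (k + g) \<omega>) -` {y. \<forall>j\<in>J n. y j = i j} \<inter> space M)"
      by (intro emeasure_distr measurable_path)
    also have "(\<lambda>\<omega> k. Y (k + g) \<omega>) -` {y. \<forall>j\<in>J n. y j = i j} \<inter> space M =
        {\<omega> \<in> space M. \<forall>j\<in>J n. Y (j + g) \<omega> = i j}" by auto
    also have "emeasure M \<dots> = ennreal (prob \<dots>)" by (rule emeasure_eq_measure)
    also have "prob {\<omega> \<in> space M. \<forall>j\<in>J n. Y (j + g) \<omega> = i j} =
      pmf init (i (- (int n + \<bar>h\<bar>))) * (\<Prod>j\<in>{- (int n + \<bar>h\<bar>)..<int n + \<bar>h\<bar>}. pmf (K (i j)) (i (j + 1)))"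
      unfolding J_def using that by (intro prob_cylinder_shift) auto
    finally show ?thesis .
  qed
  show ?thesis
  proof (rule measure_eqI_generator_eq[where E = E and A = A and \<Omega> = UNIV])
    show "Int_stable E" unfolding E_def by (rule Int_stable_cylinders[OF J(1)])
    fix B assume "B \<in> E"
    then show "emeasure (distr M paths (\<lambda>\<omega> k. Y (k + h) \<omega>)) B = emeasure (distr M paths (\<lambda>\<omega> k. Y k \<omega>)) B"
      using em[of h] em[of 0] by (auto simp: E_def cylinders_def)
  qed (use A sets in auto)
qed

lemma distr_Y: "distr M (count_space UNIV) (Y k) = measure_pmf init"
proof -
  have "distr M (count_space UNIV) (Y k) = distr (distr M paths (\<lambda>\<omega> l. Y (l + k) \<omega>)) (count_space UNIV) (\<lambda>y. y 0)"
    by (subst distr_distr) (auto intro!: measurable_path simp: o_def)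
  also have "\<dots> = distr (distr M paths (\<lambda>\<omega> l. Y l \<omega>)) (count_space UNIV) (\<lambda>y. y 0)"
    by (simp add: stationary)
  also have "\<dots> = distr M (count_space UNIV) (Y 0)"
    using measurable_path[of 0] by (subst distr_distr) (auto simp: o_def)
  also have "\<dots> = measure_pmf init"
  proof (rule measure_eqI_countable[where A = UNIV])
    fix s
    have "emeasure (distr M (count_space UNIV) (Y 0)) {s} = emeasure M {\<omega> \<in> space M. Y 0 \<omega> = s}"
      by (subst emeasure_distr) (auto intro!: arg_cong[where f = "emeasure M"])
    also have "\<dots> = pmf init s"
      using prob_cylinder[of 0 0 "\<lambda>_. s"] by (simp add: emeasure_eq_measure)
    finally show "emeasure (distr M (count_space UNIV) (Y 0)) {s} = emeasure init {s}"
      by (simp add: emeasure_pmf_single)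
  qed auto
  finally show ?thesis .
qed

text \<open>Stationarity moves the pair to times 0 and 1, where its law is read off a two-point
  cylinder.\<close>

lemma nn_integral_pair:
  "(\<integral>\<^sup>+\<omega>. \<phi> (Y k \<omega>) (Y (k + 1) \<omega>) \<partial>M) = (\<integral>\<^sup>+s. \<integral>\<^sup>+t. \<phi> s t \<partial>K s \<partial>init)"
proof -
  let ?C = "count_space (UNIV :: ('s \<times> 's) set)"
  let ?p = "bind_pmf init (\<lambda>s. map_pmf (Pair s) (K s))"
  have m: "(\<lambda>\<omega>. (Y i \<omega>, Y j \<omega>)) \<in> measurable M ?C" for i j
    by (subst measurable_count_space_eq_countable) (auto intro!: measurable_sets_Collect)
  have m': "(\<lambda>y. (y i, y j)) \<in> measurable paths ?C" for i j :: int
    by (subst measurable_count_space_eq_countable) (auto)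
  have "distr M ?C (\<lambda>\<omega>. (Y k \<omega>, Y (k + 1) \<omega>)) =
      distr (distr M paths (\<lambda>\<omega> l. Y (l + k) \<omega>)) ?C (\<lambda>y. (y 0, y 1))"
    by (subst distr_distr[OF m' measurable_path]) (simp add: o_def add.commute)
  also have "\<dots> = distr (distr M paths (\<lambda>\<omega> l. Y l \<omega>)) ?C (\<lambda>y. (y 0, y 1))"
    by (simp add: stationary)
  also have "\<dots> = distr M ?C (\<lambda>\<omega>. (Y 0 \<omega>, Y 1 \<omega>))"
    using measurable_path[of 0] by (subst distr_distr[OF m']) (auto simp: o_def)
  also have "\<dots> = measure_pmf ?p"
  proof (rule measure_eqI_countable[where A = UNIV])
    fix x :: "'s \<times> 's"
    obtain s t where x: "x = (s, t)" by (cases x)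
    have "emeasure (distr M ?C (\<lambda>\<omega>. (Y 0 \<omega>, Y 1 \<omega>))) {x} =
        emeasure M {\<omega> \<in> space M. \<forall>j\<in>{0..1::int}. Y j \<omega> = (if j = 0 then s else t)}"
    proof -
      have "{0..1::int} = {0, 1}" by auto
      then show ?thesis
        by (subst emeasure_distr[OF m]) (auto simp: x intro!: arg_cong[where f = "emeasure M"])
    qed
    also have "\<dots> = pmf init s * pmf (K s) t"
      using prob_cylinder[of 0 1 "\<lambda>j. if j = 0 then s else t"] by (simp add: emeasure_eq_measure)
    also have "pmf init s * pmf (K s) t = pmf ?p x"
    proof -
      have "pmf (map_pmf (Pair u) (K u)) (s, t) = (if u = s then pmf (K s) t else 0)" for u
        using pmf_map_inj'[of "Pair s" "K s" t]
        by (auto simp: inj_def pmf_eq_0_set_pmf)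
      then have "pmf ?p x = measure_pmf.expectation init (\<lambda>u. pmf (K s) t * indicator {s} u)"
        unfolding pmf_bind x by (intro Bochner_Integration.integral_cong) (auto simp: indicator_def)
      then show ?thesis by (simp add: pmf.rep_eq mult.commute)
    qed
    finally show "emeasure (distr M ?C (\<lambda>\<omega>. (Y 0 \<omega>, Y 1 \<omega>))) {x} = emeasure ?p {x}"
      by (simp add: emeasure_pmf_single)
  qed auto
  finally have d: "distr M ?C (\<lambda>\<omega>. (Y k \<omega>, Y (k + 1) \<omega>)) = measure_pmf ?p" .
  have "(\<integral>\<^sup>+\<omega>. \<phi> (Y k \<omega>) (Y (k + 1) \<omega>) \<partial>M) =
      (\<integral>\<^sup>+x. case_prod \<phi> x \<partial>distr M ?C (\<lambda>\<omega>. (Y k \<omega>, Y (k + 1) \<omega>)))"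
    by (subst nn_integral_distr[OF m]) auto
  also have "\<dots> = (\<integral>\<^sup>+s. \<integral>\<^sup>+t. \<phi> s t \<partial>K s \<partial>init)"
    unfolding d by simp
  finally show ?thesis .
qed

section \<open>Conditional expectations given all other times\<close>

lemma set_integral_cylinder:
  fixes u :: "'s \<Rightarrow> real"
  assumes N: "\<bar>k\<bar> < N" and fin: "finite (set_pmf (K (i (k - 1))))"
  shows "(LINT \<omega>:{\<omega> \<in> space M. \<forall>j\<in>{-N..N} - {k}. Y j \<omega> = i j}|M. u (Y k \<omega>)) =
    pmf init (i (-N)) * (\<Prod>j\<in>{-N..<N} - {k - 1, k}. pmf (K (i j)) (i (j + 1))) *
    measure_pmf.expectation (K (i (k - 1))) (\<lambda>s. u s * pmf (K s) (i (k + 1)))"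
    (is "(LINT \<omega>:?C|M. _) = ?D * _")
proof -
  let ?S = "set_pmf (K (i (k - 1)))"
  let ?B = "\<lambda>s. {\<omega> \<in> space M. \<forall>j\<in>{-N..N}. Y j \<omega> = (i(k := s)) j}"
  have B: "\<omega> \<in> ?B s \<longleftrightarrow> \<omega> \<in> ?C \<and> Y k \<omega> = s" for \<omega> s
  proof -
    have "k \<in> {-N..N}" using N by auto
    then show ?thesis by auto
  qed
  have meas [measurable]: "?B s \<in> sets M" for s by measurable
  \<comment> \<open>Only the factors at \<open>j = k - 1\<close> and \<open>j = k\<close> involve
    the value \<open>s\<close> at time \<open>k\<close>. The bound \<open>\<bar>k\<bar> < N\<close>
    keeps both inside the product and the initial factor \<open>i (-N)\<close> untouched.\<close>
  have prob_B: "prob (?B s) = ?D * (pmf (K (i (k - 1))) s * pmf (K s) (i (k + 1)))" for s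
  proof -
    let ?f = "\<lambda>j. pmf (K ((i(k := s)) j)) ((i(k := s)) (j + 1))"
    have "prob (?B s) = pmf init (i (-N)) * prod ?f {-N..<N}"
    proof -
      have "- N \<noteq> k" "- N \<le> 0" "0 \<le> N" using N by auto
      then show ?thesis using prob_cylinder[of "-N" N "i(k := s)"] by simp
    qed
    also have "prod ?f {-N..<N} = ?f (k - 1) * prod ?f ({-N..<N} - {k - 1})"
      using N by (intro prod.remove) auto
    also have "prod ?f ({-N..<N} - {k - 1}) = ?f k * prod ?f ({-N..<N} - {k - 1} - {k})"
      using N by (intro prod.remove) auto
    also have "prod ?f ({-N..<N} - {k - 1} - {k}) = (\<Prod>j\<in>{-N..<N} - {k - 1, k}. pmf (K (i j)) (i (j + 1)))"
      by (rule prod.cong) auto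
    finally show ?thesis by (simp add: mult_ac)
  qed
  \<comment> \<open>States outside the support of \<open>K (i (k - 1))\<close> carry no mass, so the
    decomposition by the value at time \<open>k\<close> becomes a finite sum.\<close>
  have "AE \<omega> in M. \<forall>s. s \<notin> ?S \<longrightarrow> \<omega> \<notin> ?B s"
  proof (subst AE_all_countable, intro allI)
    fix s
    show "AE \<omega> in M. s \<notin> ?S \<longrightarrow> \<omega> \<notin> ?B s"
    proof (cases "s \<in> ?S")
      case False
      then have "prob (?B s) = 0" unfolding prob_B by (simp add: set_pmf_iff)
      then have "AE \<omega> in M. \<omega> \<notin> ?B s" by (subst prob_eq_0[symmetric]) auto
      then show ?thesis by eventually_elim simp
    qed simp
  qed
  then have ae: "AE \<omega> in M. indicator ?C \<omega> *\<^sub>R u (Y k \<omega>) = (\<Sum>s\<in>?S. u s * indicator (?B s) \<omega>)"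
  proof eventually_elim
    case (elim \<omega>)
    show ?case
    proof (cases "\<omega> \<in> ?C")
      case True
      then have "Y k \<omega> \<in> ?S" using elim B by blast
      moreover have "u s * indicator (?B s) \<omega> = (if s = Y k \<omega> then u s else 0)" for s
        using True B[of \<omega> s] by (auto simp: indicator_def)
      ultimately show ?thesis using True fin by simp
    next
      case False
      then have "indicator (?B s) \<omega> = (0 :: real)" for s
        using B by (simp add: indicator_def)
      then show ?thesis using False by simp
    qed
  qed
  have "(LINT \<omega>:?C|M. u (Y k \<omega>)) = (\<integral>\<omega>. (\<Sum>s\<in>?S. u s * indicator (?B s) \<omega>) \<partial>M)"
    unfolding set_lebesgue_integral_def by (rule integral_cong_AE) (use ae in auto)
  also have "\<dots> = (\<Sum>s\<in>?S. u s * prob (?B s))"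
    by (subst Bochner_Integration.integral_sum)
      (auto intro!: integrable_mult_right simp: emeasure_eq_measure simp del: fun_upd_apply)
  also have "\<dots> = ?D * (\<Sum>s\<in>?S. u s * pmf (K s) (i (k + 1)) * pmf (K (i (k - 1))) s)"
    unfolding prob_B by (simp add: sum_distrib_left mult_ac)
  also have "(\<Sum>s\<in>?S. u s * pmf (K s) (i (k + 1)) * pmf (K (i (k - 1))) s) =
      measure_pmf.expectation (K (i (k - 1))) (\<lambda>s. u s * pmf (K s) (i (k + 1)))"
    using fin by (subst integral_measure_pmf_real[of ?S]) auto
  finally show ?thesis .
qed

text \<open>On a cylinder all times other than \<open>k\<close> and its neighbours enter only
  through a common factor, so conditioning reduces to the bridge from \<open>Y (k - 1)\<close> to
  \<open>Y (k + 1)\<close>. The hypothesis \<open>bridge\<close> is multiplied out to cover pairs of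
  states with no bridge between them. The family \<open>\<S>\<close> leaves room for state sets that
  are preimages under the position map.\<close>

lemma real_cond_exp_neighbours:
  fixes h :: "'s \<Rightarrow> real" and G :: "'s \<Rightarrow> 's \<Rightarrow> real" and F :: "'b measure"
  assumes F: "space F = space M"
    "sets F = sigma_sets (space M) {{\<omega> \<in> space M. Y j \<omega> \<in> S} | j S. j \<noteq> k \<and> S \<in> \<S>}"
    and fin: "\<And>s. finite (set_pmf (K s))"
    and bridge: "\<And>s t. measure_pmf.expectation (K s) (\<lambda>y. h y * pmf (K y) t) =
      G s t * measure_pmf.expectation (K s) (\<lambda>y. pmf (K y) t)"
    and int: "integrable M (\<lambda>\<omega>. h (Y k \<omega>))" "integrable M (\<lambda>\<omega>. G (Y (k - 1) \<omega>) (Y (k + 1) \<omega>))"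
    and meas: "(\<lambda>\<omega>. G (Y (k - 1) \<omega>) (Y (k + 1) \<omega>)) \<in> borel_measurable F"
  shows "AE \<omega> in M. real_cond_exp M F (\<lambda>\<omega>. h (Y k \<omega>)) \<omega> = G (Y (k - 1) \<omega>) (Y (k + 1) \<omega>)"
proof -
  \<comment> \<open>The bound exceeds \<open>\<bar>k\<bar>\<close>, as
    \<open>set_integral_cylinder\<close> requires, so both neighbours of \<open>k\<close> lie in
    every window.\<close>
  define J :: "nat \<Rightarrow> int set" where "J n = {- (int n + \<bar>k\<bar> + 1)..int n + \<bar>k\<bar> + 1} - {k}" for n
  define E where "E = cylinders (space M) Y J"
  have J: "mono J" "finite (J n)" for n by (auto simp: J_def mono_def)
  have E: "E \<subseteq> sets M"
  proof
    fix A assume "A \<in> E"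
    then have "A = {} \<or> (\<exists>n i. A = {\<omega> \<in> space M. \<forall>j\<in>J n. Y j \<omega> = i j})"
      by (auto simp: E_def cylinders_def)
    moreover have "{\<omega> \<in> space M. \<forall>j\<in>J n. Y j \<omega> = i j} \<in> sets M" for n i
      using J(2)[of n] by measurable
    ultimately show "A \<in> sets M" by auto
  qed
  have sub: "subalgebra M F"
    unfolding subalgebra_def F by (auto intro!: sets.sigma_sets_subset)
  interpret finite_measure_subalgebra M F by unfold_locales (rule sub)
  obtain A where A: "range A \<subseteq> E" "disjoint_family A" "(\<Union>n::nat. A n) = space M"
    using cylinders_partition[where J = J and n = 0 and \<Omega> = "space M" and Y = Y] J(2)[of 0]
    unfolding E_def by metis
  have eq: "(LINT \<omega>:A|M. h (Y k \<omega>)) = (LINT \<omega>:A|M. G (Y (k - 1) \<omega>) (Y (k + 1) \<omega>))"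
    if "A \<in> E" for A
  proof (cases "A = {}")
    case True
    then show ?thesis by (simp add: set_lebesgue_integral_def)
  next
    case False
    with that obtain n i where A: "A = {\<omega> \<in> space M. \<forall>j\<in>J n. Y j \<omega> = i j}"
      by (auto simp: E_def cylinders_def)
    \<comment> \<open>Applied to \<open>h\<close> and to the constant 1, this gives numerator and
      denominator of the bridge with one and the same prefactor.\<close>
    note c = set_integral_cylinder[of k "int n + \<bar>k\<bar> + 1" i, OF _ fin, folded J_def A]
    have "(LINT \<omega>:A|M. G (Y (k - 1) \<omega>) (Y (k + 1) \<omega>)) = (LINT \<omega>:A|M. G (i (k - 1)) (i (k + 1)) * 1)"
    proof (rule set_lebesgue_integral_cong)
      have "k - 1 \<in> J n" "k + 1 \<in> J n" by (auto simp: J_def)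
      then show "\<forall>\<omega>. \<omega> \<in> A \<longrightarrow> G (Y (k - 1) \<omega>) (Y (k + 1) \<omega>) = G (i (k - 1)) (i (k + 1)) * 1"
        by (auto simp: A)
    qed (use E that in auto)
    also have "\<dots> = G (i (k - 1)) (i (k + 1)) * (LINT \<omega>:A|M. 1)"
      by (rule set_integral_mult_right)
    finally show ?thesis
      using c[of h] c[of "\<lambda>_. 1"] by (simp add: bridge mult_ac)
  qed
  show ?thesis
  proof (rule real_cond_exp_charact)
    fix B assume "B \<in> sets F"
    \<comment> \<open>The identity is proved on the sigma-algebra generated by the cylinders and
      then restricted to \<open>F\<close>.\<close>
    moreover have "sets F \<subseteq> sigma_sets (space M) E"
    proof -
      have "{\<omega> \<in> space M. Y j \<omega> \<in> S} \<in> sigma_sets (space M) E" if "j \<noteq> k" for j S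
        unfolding E_def
        by (rule coordinate_in_sigma_cylinders[of J "nat \<bar>j\<bar>", OF J(2)]) (use that in \<open>auto simp: J_def\<close>)
      then show ?thesis unfolding F by (intro sigma_sets_mono) auto
    qed
    ultimately have "B \<in> sigma_sets (space M) E" by blast
    then show "(LINT \<omega>:B|M. h (Y k \<omega>)) = (LINT \<omega>:B|M. G (Y (k - 1) \<omega>) (Y (k + 1) \<omega>))"
      using J(1) by (intro set_integral_eq_generator[OF int _ E eq A])
        (auto simp: E_def Int_stable_cylinders)
  qed (use int meas in auto)
qed

end

text \<open>Serves to move the chain from the space of innovations to the space of real paths that
  the final statement asks for.\<close>

lemma two_sided_chain_distr:
  assumes chain: "two_sided_chain M Y init K" and f: "f \<in> measurable M N"
    and g: "\<And>k. g k \<in> measurable N (count_space UNIV)" and gf: "\<And>k \<omega>. g k (f \<omega>) = Y k \<omega>"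
  shows "two_sided_chain (distr M N f) g init K"
proof -
  interpret two_sided_chain M Y init K by (rule chain)
  interpret N: prob_space "distr M N f" by (rule prob_space_distr[OF f])
  show ?thesis
  proof
    fix a b :: int and i assume ab: "a \<le> 0" "0 \<le> b"
    have "{x \<in> space N. \<forall>j\<in>{a..b}. g j x = i j} \<in> sets N"
      using g by measurable
    then have "measure (distr M N f) {x \<in> space N. \<forall>j\<in>{a..b}. g j x = i j} =
        prob (f -` {x \<in> space N. \<forall>j\<in>{a..b}. g j x = i j} \<inter> space M)"
      by (rule measure_distr[OF f])
    also have "f -` {x \<in> space N. \<forall>j\<in>{a..b}. g j x = i j} \<inter> space M =
        {\<omega> \<in> space M. \<forall>j\<in>{a..b}. Y j \<omega> = i j}"
      using measurable_space[OF f] by (auto simp: gf)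
    finally show "measure (distr M N f) {x \<in> space (distr M N f). \<forall>j\<in>{a..b}. g j x = i j} =
        pmf init (i a) * (\<Prod>j\<in>{a..<b}. pmf (K (i j)) (i (j + 1)))"
      using prob_cylinder[OF ab] by simp
  qed (use g in auto)
qed

text \<open>
  Coordinate \<open>None\<close> is the state at time \<open>0\<close>; coordinate \<open>Some (k, s)\<close> is the state at time \<open>k\<close> in
  case \<open>s\<close> is the state at the neighbouring time closer to \<open>0\<close>. All coordinates are independent, so
  a cylinder event only fixes finitely many of them. For a reversible kernel the past can be
  generated with the same kernel as the future.
\<close>

fun forward_path :: "((int \<times> 's) option \<Rightarrow> 's) \<Rightarrow> nat \<Rightarrow> 's" where
  "forward_path \<omega> 0 = \<omega> None"
| "forward_path \<omega> (Suc n) = \<omega> (Some (int (Suc n), forward_path \<omega> n))"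

fun backward_path :: "((int \<times> 's) option \<Rightarrow> 's) \<Rightarrow> nat \<Rightarrow> 's" where
  "backward_path \<omega> 0 = \<omega> None"
| "backward_path \<omega> (Suc n) = \<omega> (Some (- int (Suc n), backward_path \<omega> n))"

definition two_sided_path :: "int \<Rightarrow> ((int \<times> 's) option \<Rightarrow> 's) \<Rightarrow> 's" where
  "two_sided_path k \<omega> = (if 0 \<le> k then forward_path \<omega> (nat k) else backward_path \<omega> (nat (- k)))"

definition toward_zero :: "int \<Rightarrow> int" where
  "toward_zero j = (if 0 < j then j - 1 else j + 1)"

definition innovation :: "(int \<Rightarrow> 's) \<Rightarrow> int \<Rightarrow> (int \<times> 's) option" where
  "innovation i j = (if j = 0 then None else Some (j, i (toward_zero j)))"

lemma two_sided_path_eq: "two_sided_path j \<omega> = \<omega> (innovation (\<lambda>l. two_sided_path l \<omega>) j)"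
proof -
  consider "j = 0" | "j > 0" | "j < 0" by linarith
  then show ?thesis
  proof cases
    case 2
    then obtain n where "j = int (Suc n)" using zero_less_imp_eq_int by (metis gr0_conv_Suc)
    then show ?thesis by (simp add: innovation_def toward_zero_def two_sided_path_def nat_add_distrib)
  next
    case 3
    then obtain n where n: "j = - int (Suc n)" by (metis minus_minus neg_0_less_iff_less zero_less_imp_eq_int gr0_conv_Suc)
    then have "toward_zero j = - int n" by (simp add: toward_zero_def)
    moreover have "two_sided_path (- int n) \<omega> = backward_path \<omega> n"
      by (cases "n = 0") (auto simp: two_sided_path_def)
    ultimately have "innovation (\<lambda>l. two_sided_path l \<omega>) j = Some (- int (Suc n), backward_path \<omega> n)"
      using n by (simp add: innovation_def)
    moreover have "two_sided_path j \<omega> = backward_path \<omega> (Suc n)"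
      unfolding n by (simp add: two_sided_path_def nat_add_distrib)
    ultimately show ?thesis by simp
  qed (simp add: innovation_def two_sided_path_def)
qed

text \<open>The right-hand side reads coordinates along the prescribed path \<open>i\<close> instead
  of the random one, so it concerns fixed coordinates of the product space. Going outwards from time
  0, agreement at one time identifies the coordinate read at the next.\<close>

lemma two_sided_path_eq_iff:
  assumes "a \<le> 0" "0 \<le> b"
  shows "(\<forall>j\<in>{a..b}. two_sided_path j \<omega> = i j) \<longleftrightarrow> (\<forall>j\<in>{a..b}. \<omega> (innovation i j) = i j)"
proof
  have t: "toward_zero j \<in> {a..b}" if "j \<in> {a..b}" "j \<noteq> 0" for j
    using that assms by (auto simp: toward_zero_def)
  have eq: "innovation i j = innovation (\<lambda>l. two_sided_path l \<omega>) j"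
    if "j \<in> {a..b}" "j \<noteq> 0 \<longrightarrow> two_sided_path (toward_zero j) \<omega> = i (toward_zero j)" for j
    using that by (simp add: innovation_def)
  {
    assume *: "\<forall>j\<in>{a..b}. two_sided_path j \<omega> = i j"
    show "\<forall>j\<in>{a..b}. \<omega> (innovation i j) = i j"
      using * t eq two_sided_path_eq by metis
  next
    assume *: "\<forall>j\<in>{a..b}. \<omega> (innovation i j) = i j"
    have "two_sided_path j \<omega> = i j" if "j \<in> {a..b}" for j
      using that
    proof (induction "nat \<bar>j\<bar>" arbitrary: j)
      case 0
      then have "j = 0" by simp
      then have "\<omega> None = i 0" using bspec[OF *, of 0] assms by (simp add: innovation_def)
      then show ?case using \<open>j = 0\<close> two_sided_path_eq[of 0 \<omega>] by (simp add: innovation_def)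
    next
      case (Suc n)
      have "n = nat \<bar>toward_zero j\<bar>" using Suc(2) by (auto simp: toward_zero_def)
      then have "two_sided_path (toward_zero j) \<omega> = i (toward_zero j)"
        using Suc t by (metis Suc_neq_Zero abs_zero nat_zero_as_int of_nat_0)
      then show ?case using * Suc(3) eq two_sided_path_eq by metis
    qed
    then show "\<forall>j\<in>{a..b}. two_sided_path j \<omega> = i j" by blast
  }
qed

text \<open>The left-hand side is what independent coordinates produce, running outwards from time
  0. Each step into the past is turned around by \<open>rev\<close>, which moves the factor of
  \<open>init\<close> from \<open>i a\<close> to \<open>i (a - 1)\<close>.\<close>

lemma reversible_cylinder_product:
  fixes init :: "'s pmf"
  assumes rev: "\<And>s t. pmf init s * pmf (K s) t = pmf init t * pmf (K t) s"
    and "a \<le> 0" "0 \<le> b"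
  shows "(\<Prod>j\<in>{a..b}. if j = 0 then pmf init (i 0) else pmf (K (i (toward_zero j))) (i j)) =
    pmf init (i a) * (\<Prod>j\<in>{a..<b}. pmf (K (i j)) (i (j + 1)))"
    (is "prod ?c _ = _ * prod ?p _")
  using \<open>a \<le> 0\<close>
proof (induction a rule: int_le_induct)
  case base
  show ?case
    using \<open>0 \<le> b\<close>
  proof (induction b rule: int_ge_induct)
    case (step b)
    have "{0..b + 1} = insert (b + 1) {0..b}" "{0..<b + 1} = insert b {0..<b}" using step by auto
    then show ?case using step by (simp add: toward_zero_def mult_ac)
  qed simp
next
  case (step a)
  have "{a - 1..b} = insert (a - 1) {a..b}" "{a - 1..<b} = insert (a - 1) {a..<b}"
    using step \<open>0 \<le> b\<close> by auto
  then have "prod ?c {a - 1..b} = (pmf init (i a) * pmf (K (i a)) (i (a - 1))) * prod ?p {a..<b}"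
    using step by (simp add: toward_zero_def mult_ac)
  also have "\<dots> = pmf init (i (a - 1)) * (pmf (K (i (a - 1))) (i a) * prod ?p {a..<b})"
    by (simp add: rev[of "i a"])
  also have "pmf (K (i (a - 1))) (i a) * prod ?p {a..<b} = prod ?p {a - 1..<b}"
    using \<open>{a - 1..<b} = insert (a - 1) {a..<b}\<close> by simp
  finally show ?case .
qed

lemma two_sided_chain_reversible:
  fixes init :: "'s::countable pmf"
  assumes rev: "\<And>s t. pmf init s * pmf (K s) t = pmf init t * pmf (K t) s"
  shows "two_sided_chain
    (Pi\<^sub>M UNIV (\<lambda>x. measure_pmf (case x of None \<Rightarrow> init | Some (_, s) \<Rightarrow> K s)))
    two_sided_path init K"
proof -
  define \<mu> where "\<mu> x = measure_pmf (case x of None \<Rightarrow> init | Some (_ :: int, s) \<Rightarrow> K s)" for x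
  interpret P: product_prob_space \<mu> UNIV
    by (rule product_prob_spaceI) (simp add: \<mu>_def prob_space_measure_pmf)
  have c: "(\<lambda>\<omega>. \<omega> x) \<in> measurable (Pi\<^sub>M UNIV \<mu>) (count_space UNIV)" for x
  proof -
    have "(\<lambda>\<omega>. \<omega> x) \<in> measurable (Pi\<^sub>M UNIV \<mu>) (\<mu> x)" by measurable
    moreover have "measurable (Pi\<^sub>M UNIV \<mu>) (\<mu> x) = measurable (Pi\<^sub>M UNIV \<mu>) (count_space UNIV)"
      by (rule measurable_cong_sets) (simp_all add: \<mu>_def)
    ultimately show ?thesis by blast
  qed
  \<comment> \<open>The index of the coordinate is itself random, but takes only countably many
    values.\<close>
  have step: "(\<lambda>\<omega>. \<omega> (Some (k, y \<omega>))) \<in> measurable (Pi\<^sub>M UNIV \<mu>) (count_space UNIV)"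
    if "y \<in> measurable (Pi\<^sub>M UNIV \<mu>) (count_space UNIV)" for y k
    using c that by (rule measurable_compose_countable[where f = "\<lambda>s \<omega>. \<omega> (Some (k, s))"])
  have "(\<lambda>\<omega>. forward_path \<omega> n) \<in> measurable (Pi\<^sub>M UNIV \<mu>) (count_space UNIV)"
    "(\<lambda>\<omega>. backward_path \<omega> n) \<in> measurable (Pi\<^sub>M UNIV \<mu>) (count_space UNIV)" for n
    by (induction n) (simp_all only: forward_path.simps backward_path.simps c step)
  then have "two_sided_path k \<in> measurable (Pi\<^sub>M UNIV \<mu>) (count_space UNIV)" for k
    unfolding two_sided_path_def[abs_def] by (cases "0 \<le> k") simp_all
  moreover have "measure (Pi\<^sub>M UNIV \<mu>) {\<omega> \<in> space (Pi\<^sub>M UNIV \<mu>). \<forall>j\<in>{a..b}. two_sided_path j \<omega> = i j} =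
      pmf init (i a) * (\<Prod>j\<in>{a..<b}. pmf (K (i j)) (i (j + 1)))"
    if ab: "a \<le> 0" "0 \<le> b" for a b i
  proof -
    \<comment> \<open>Recovers the time from a coordinate. Hence different times use different
      coordinates, and the product measure factorises over the window.\<close>
    define idx :: "(int \<times> 's) option \<Rightarrow> int" where "idx x = (case x of None \<Rightarrow> 0 | Some (j, _) \<Rightarrow> j)" for x
    have idx: "idx (innovation i j) = j" for j by (simp add: idx_def innovation_def)
    then have inj: "inj_on (innovation i) {a..b}" by (metis inj_onI)
    have "{\<omega> \<in> space (Pi\<^sub>M UNIV \<mu>). \<forall>j\<in>{a..b}. two_sided_path j \<omega> = i j} =
        {\<omega> \<in> space (Pi\<^sub>M UNIV \<mu>). \<forall>x\<in>innovation i ` {a..b}. \<omega> x \<in> {i (idx x)}}"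
      by (simp add: two_sided_path_eq_iff[OF ab] idx)
    also have "emeasure (Pi\<^sub>M UNIV \<mu>) \<dots> = (\<Prod>x\<in>innovation i ` {a..b}. emeasure (\<mu> x) {i (idx x)})"
      by (rule P.emeasure_PiM_Collect) (auto simp: \<mu>_def)
    also have "\<dots> = (\<Prod>j\<in>{a..b}. emeasure (\<mu> (innovation i j)) {i j})"
      by (subst prod.reindex[OF inj]) (simp add: idx)
    also have "\<dots> = (\<Prod>j\<in>{a..b}. ennreal (if j = 0 then pmf init (i 0) else pmf (K (i (toward_zero j))) (i j)))"
      by (rule prod.cong) (auto simp: \<mu>_def innovation_def emeasure_pmf_single)
    also have "\<dots> = ennreal (\<Prod>j\<in>{a..b}. if j = 0 then pmf init (i 0) else pmf (K (i (toward_zero j))) (i j))"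
      by (rule prod_ennreal) auto
    also have "\<dots> = ennreal (pmf init (i a) * (\<Prod>j\<in>{a..<b}. pmf (K (i j)) (i (j + 1))))"
      by (simp only: reversible_cylinder_product[OF rev ab])
    finally show ?thesis
      by (simp add: measure_def prod_nonneg)
  qed
  ultimately have "two_sided_chain (Pi\<^sub>M UNIV \<mu>) two_sided_path init K"
    by unfold_locales
  then show ?thesis by (simp add: \<mu>_def[abs_def])
qed

section \<open>Bridges of the lattice chain\<close>

context q_lattice
begin

lemma bridge_expectation:
  "measure_pmf.expectation (kernel n s) (\<lambda>y. h y * pmf (kernel n y) t) =
    (step ^^ n) (\<lambda>y. h y * (step ^^ n) (indicator {t}) y) s"
  by (simp add: expectation_kernel pmf_kernel)

lemma bridge_denominator:
  "measure_pmf.expectation (kernel n s) (\<lambda>y. pmf (kernel n y) t) = (step ^^ n) ((step ^^ n) (indicator {t})) s"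
  by (simp add: expectation_kernel pmf_kernel[abs_def])

lemma mult_f_indicator: "mult_f (indicator {t}) = (\<lambda>x. pt t * indicator {t} x)"
  by (auto simp: mult_f_def indicator_def)

text \<open>The operator identity is evaluated at \<open>s\<close> on the indicator of
  \<open>t\<close>: multiplication by the position before the transition operators contributes
  \<open>pt t\<close>, multiplication after them \<open>pt s\<close>.\<close>

lemma bridge_linear:
  assumes "0 < n" "\<rho> = 1 / r ^ n"
  shows "measure_pmf.expectation (kernel n s) (\<lambda>y. pt y * pmf (kernel n y) t) =
    bryc_L \<rho> * (pt s + pt t) * measure_pmf.expectation (kernel n s) (\<lambda>y. pmf (kernel n y) t)"
  using linear_regression_operator[OF assms refl, of "indicator {t}" s]
  unfolding bridge_expectation bridge_denominator mult_f_indicator linop_simps[OF linop_funpow[OF linop_T]]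
  by (simp add: mult_f_def algebra_simps)

lemma bridge_quadratic:
  assumes "2 \<le> n" "\<rho> = 1 / r ^ n" "q = r\<^sup>2"
  shows "measure_pmf.expectation (kernel n s) (\<lambda>y. (pt y)\<^sup>2 * pmf (kernel n y) t) =
    (bryc_A \<rho> q * ((pt s)\<^sup>2 + (pt t)\<^sup>2) + bryc_B \<rho> q * pt s * pt t + bryc_C \<rho> q) *
      measure_pmf.expectation (kernel n s) (\<lambda>y. pmf (kernel n y) t)"
  using quadratic_regression_operator[OF _ assms(2) refl assms(3) assms(1), of "indicator {t}" s] assms(1)
  unfolding bridge_expectation bridge_denominator mult_f_indicator linop_simps[OF linop_funpow[OF linop_T]]
    linop_simps[OF linop_mult_f]
  by (simp add: mult_f_indicator linop_simps[OF linop_funpow[OF linop_T]])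
    (simp add: mult_f_def algebra_simps power2_eq_square)

end

section \<open>The Bryc process\<close>

context q_lattice
begin

lemma bryc_process_of_chain:
  assumes chain: "two_sided_chain M Y stat (kernel n)" and n: "2 \<le> n"
    and \<rho>: "\<rho> = 1 / r ^ n" and q: "q = r\<^sup>2"
  shows "bryc_process M (\<lambda>k \<omega>. pt (Y k \<omega>)) \<rho> q"
proof -
  interpret two_sided_chain M Y stat "kernel n" by (rule chain)
  have \<rho>1: "0 < \<rho>" "\<rho> < 1"
    using n r_gt_1 by (simp_all add: \<rho>)
  have X [measurable]: "(\<lambda>\<omega>. pt (Y k \<omega>)) \<in> borel_measurable M" for k
    by measurable
  have marginal: "integrable M (\<lambda>\<omega>. g (Y k \<omega>)) \<longleftrightarrow> integrable stat g"
    "expectation (\<lambda>\<omega>. g (Y k \<omega>)) = measure_pmf.expectation stat g" for g :: "int \<Rightarrow> real" and k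
    using integrable_distr_eq[OF measurable_Y[of k], of g] integral_distr[OF measurable_Y[of k], of g]
    by (simp_all add: distr_Y)
  have square: "integrable M (\<lambda>\<omega>. (pt (Y k \<omega>))\<^sup>2)" "expectation (\<lambda>\<omega>. (pt (Y k \<omega>))\<^sup>2) = 1" for k
    using stat_second_moment marginal[of "\<lambda>i. (pt i)\<^sup>2" k] by (simp_all add: has_bochner_integral_iff)
  have X_int: "integrable M (\<lambda>\<omega>. pt (Y k \<omega>))" for k
    by (rule square_integrable_imp_integrable[OF X square(1)])
  have prod_int: "integrable M (\<lambda>\<omega>. pt (Y j \<omega>) * pt (Y k \<omega>))" for j k
  proof (rule Bochner_Integration.integrable_bound)
    show "integrable M (\<lambda>\<omega>. (pt (Y j \<omega>))\<^sup>2 + (pt (Y k \<omega>))\<^sup>2)" using square by simp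
    have "\<bar>a * b\<bar> \<le> a\<^sup>2 + b\<^sup>2" for a b :: real
    proof -
      have "2 * (\<bar>a\<bar> * \<bar>b\<bar>) \<le> a\<^sup>2 + b\<^sup>2"
        using sum_squares_bound[of "\<bar>a\<bar>" "\<bar>b\<bar>"] by simp
      moreover have "0 \<le> \<bar>a\<bar> * \<bar>b\<bar>" by simp
      ultimately show ?thesis unfolding abs_mult by linarith
    qed
    then show "AE \<omega> in M. norm (pt (Y j \<omega>) * pt (Y k \<omega>)) \<le> norm ((pt (Y j \<omega>))\<^sup>2 + (pt (Y k \<omega>))\<^sup>2)"
      by (simp add: abs_mult)
  qed measurable
  have corr: "expectation (\<lambda>\<omega>. pt (Y k \<omega>) * pt (Y (k + 1) \<omega>)) = \<rho>" for k
  proof -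
    \<comment> \<open>The square is nonnegative, so its integral can be computed from the pair law without integrability.\<close>
    let ?Z = "\<lambda>\<omega>. (pt (Y k \<omega>) + pt (Y (k + 1) \<omega>))\<^sup>2"
    have Z: "?Z = (\<lambda>\<omega>. (pt (Y k \<omega>))\<^sup>2 + (pt (Y (k + 1) \<omega>))\<^sup>2 + 2 * (pt (Y k \<omega>) * pt (Y (k + 1) \<omega>)))"
      by (simp add: fun_eq_iff power2_sum)
    have "ennreal (expectation ?Z) = (\<integral>\<^sup>+\<omega>. ennreal (?Z \<omega>) \<partial>M)"
      by (rule nn_integral_eq_integral[symmetric]) (auto simp: Z intro!: square prod_int)
    also have "\<dots> = (\<integral>\<^sup>+s. \<integral>\<^sup>+t. ennreal ((pt s + pt t)\<^sup>2) \<partial>kernel n s \<partial>stat)"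
      by (rule nn_integral_pair)
    also have "\<dots> = (\<integral>\<^sup>+s. ennreal ((1 + \<rho>)\<^sup>2 * (pt s)\<^sup>2 + (1 - \<rho>\<^sup>2)) \<partial>stat)"
    proof (rule nn_integral_cong)
      fix s
      have "(\<integral>\<^sup>+t. ennreal ((pt s + pt t)\<^sup>2) \<partial>kernel n s) =
          ennreal (measure_pmf.expectation (kernel n s) (\<lambda>t. (pt s + pt t)\<^sup>2))"
        by (rule nn_integral_eq_integral) (auto intro!: integrable_measure_pmf_finite finite_set_kernel)
      also have "measure_pmf.expectation (kernel n s) (\<lambda>t. (pt s + pt t)\<^sup>2) =
          measure_pmf.expectation (kernel n s) (\<lambda>t. (pt s)\<^sup>2 + (pt t)\<^sup>2 + 2 * pt s * pt t)"
        by (simp add: power2_sum)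
      also have "\<dots> = (pt s)\<^sup>2 + (step ^^ n) (\<lambda>t. (pt t)\<^sup>2) s + 2 * pt s * (step ^^ n) pt s"
        by (simp add: expectation_kernel[symmetric] integrable_measure_pmf_finite finite_set_kernel)
      also have "\<dots> = (1 + \<rho>)\<^sup>2 * (pt s)\<^sup>2 + (1 - \<rho>\<^sup>2)"
        unfolding funpow_step_pt funpow_step_pt_sq \<rho>
        by (simp add: power2_eq_square algebra_simps add_divide_distrib)
      finally show "(\<integral>\<^sup>+t. ennreal ((pt s + pt t)\<^sup>2) \<partial>kernel n s) =
          ennreal ((1 + \<rho>)\<^sup>2 * (pt s)\<^sup>2 + (1 - \<rho>\<^sup>2))" .
    qed
    also have "\<dots> = ennreal (measure_pmf.expectation stat (\<lambda>s. (1 + \<rho>)\<^sup>2 * (pt s)\<^sup>2 + (1 - \<rho>\<^sup>2)))"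
    proof (rule nn_integral_eq_integral)
      show "integrable stat (\<lambda>s. (1 + \<rho>)\<^sup>2 * (pt s)\<^sup>2 + (1 - \<rho>\<^sup>2))"
        using stat_second_moment by (simp add: has_bochner_integral_iff)
      have "\<rho>\<^sup>2 \<le> 1" using \<rho>1 by (simp add: power_le_one)
      then show "AE s in stat. 0 \<le> (1 + \<rho>)\<^sup>2 * (pt s)\<^sup>2 + (1 - \<rho>\<^sup>2)" by simp
    qed
    also have "measure_pmf.expectation stat (\<lambda>s. (1 + \<rho>)\<^sup>2 * (pt s)\<^sup>2 + (1 - \<rho>\<^sup>2)) =
        (1 + \<rho>)\<^sup>2 + (1 - \<rho>\<^sup>2)"
      using stat_second_moment by (simp add: has_bochner_integral_iff)
    also have "(1 + \<rho>)\<^sup>2 + (1 - \<rho>\<^sup>2) = 2 + 2 * \<rho>"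
      by (simp add: power2_sum)
    finally have "expectation ?Z = 2 + 2 * \<rho>"
      using \<rho>1 by (subst (asm) ennreal_inj) auto
    \<comment> \<open>Polarisation: with unit second moments, the value of
      \<open>expectation ?Z\<close> leaves \<open>\<rho>\<close> for the mixed term.\<close>
    moreover have "expectation ?Z = 1 + 1 + 2 * expectation (\<lambda>\<omega>. pt (Y k \<omega>) * pt (Y (k + 1) \<omega>))"
      unfolding Z by (simp add: square prod_int)
    ultimately show ?thesis by simp
  qed
  have stationary_X: "strictly_stationary M (\<lambda>k \<omega>. pt (Y k \<omega>))"
  proof -
    let ?B = "Pi\<^sub>M UNIV (\<lambda>_. borel) :: (int \<Rightarrow> real) measure"
    have pt_path: "(\<lambda>y k. pt (y k)) \<in> measurable paths ?B"
      by (intro measurable_PiM_single') (auto intro: measurable_compose[OF measurable_component_singleton])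
    have "distr M ?B (\<lambda>\<omega> k. pt (Y (k + h) \<omega>)) = distr (distr M paths (\<lambda>\<omega> k. Y (k + h) \<omega>)) ?B (\<lambda>y k. pt (y k))" for h
      by (subst distr_distr[OF pt_path measurable_path]) (simp add: o_def)
    from this this[of 0] show ?thesis
      unfolding strictly_stationary_def by (simp add: stationary)
  qed
  define F where "F k = sigma_others M (\<lambda>k \<omega>. pt (Y k \<omega>)) k" for k
  \<comment> \<open>Brings \<open>sigma_others\<close> into the form expected by
    \<open>real_cond_exp_neighbours\<close>, with preimages of Borel sets under \<open>pt\<close> as
    the state sets.\<close>
  have F: "space (F k) = space M"
    "sets (F k) = sigma_sets (space M) {{\<omega> \<in> space M. Y j \<omega> \<in> S} | j S. j \<noteq> k \<and> S \<in> (\<lambda>S. pt -` S) ` sets borel}" for k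
  proof -
    have "{(\<lambda>\<omega>. pt (Y j \<omega>)) -` S \<inter> space M | j S. j \<noteq> k \<and> S \<in> sets borel} \<subseteq> Pow (space M)" by auto
    moreover have "{(\<lambda>\<omega>. pt (Y j \<omega>)) -` S \<inter> space M | j S. j \<noteq> k \<and> S \<in> sets borel} =
        {{\<omega> \<in> space M. Y j \<omega> \<in> S} | j S. j \<noteq> k \<and> S \<in> (\<lambda>S. pt -` S) ` sets borel}"
    proof -
      have "(\<lambda>\<omega>. pt (Y j \<omega>)) -` S \<inter> space M = {\<omega> \<in> space M. Y j \<omega> \<in> pt -` S}" for j S by auto
      then show ?thesis by (simp only:) blast
    qed
    ultimately show "space (F k) = space M"
      "sets (F k) = sigma_sets (space M) {{\<omega> \<in> space M. Y j \<omega> \<in> S} | j S. j \<noteq> k \<and> S \<in> (\<lambda>S. pt -` S) ` sets borel}"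
      by (simp_all add: F_def sigma_others_def)
  qed
  have X_F [measurable]: "(\<lambda>\<omega>. pt (Y j \<omega>)) \<in> borel_measurable (F k)" if "j \<noteq> k" for j k
  proof (rule measurableI)
    fix S :: "real set" assume "S \<in> sets borel"
    then have "{\<omega> \<in> space M. Y j \<omega> \<in> pt -` S} \<in> sets (F k)"
      unfolding F(2) using that by (intro sigma_sets.Basic) blast
    also have "{\<omega> \<in> space M. Y j \<omega> \<in> pt -` S} = (\<lambda>\<omega>. pt (Y j \<omega>)) -` S \<inter> space (F k)"
      by (auto simp: F(1))
    finally show "(\<lambda>\<omega>. pt (Y j \<omega>)) -` S \<inter> space (F k) \<in> sets (F k)" .
  qed auto
  have X_F' [measurable]: "(\<lambda>\<omega>. pt (Y (k - 1) \<omega>)) \<in> borel_measurable (F k)"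
    "(\<lambda>\<omega>. pt (Y (k + 1) \<omega>)) \<in> borel_measurable (F k)" for k
    by (simp_all add: X_F)
  have linear: "AE \<omega> in M. real_cond_exp M (F k) (\<lambda>\<omega>. pt (Y k \<omega>)) \<omega> =
      bryc_L \<rho> * (pt (Y (k - 1) \<omega>) + pt (Y (k + 1) \<omega>))" for k
    using n by (intro real_cond_exp_neighbours[OF F, where G = "\<lambda>s t. bryc_L \<rho> * (pt s + pt t)"]
        finite_set_kernel bridge_linear \<rho> X_int integrable_mult_right Bochner_Integration.integrable_add) auto
  have quadratic: "AE \<omega> in M. real_cond_exp M (F k) (\<lambda>\<omega>. (pt (Y k \<omega>))\<^sup>2) \<omega> =
      bryc_A \<rho> q * ((pt (Y (k - 1) \<omega>))\<^sup>2 + (pt (Y (k + 1) \<omega>))\<^sup>2) +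
      bryc_B \<rho> q * pt (Y (k - 1) \<omega>) * pt (Y (k + 1) \<omega>) + bryc_C \<rho> q" for k
    using n square(1) prod_int
    by (intro real_cond_exp_neighbours[OF F, where h = "\<lambda>s. (pt s)\<^sup>2" and
          G = "\<lambda>s t. bryc_A \<rho> q * ((pt s)\<^sup>2 + (pt t)\<^sup>2) + bryc_B \<rho> q * pt s * pt t + bryc_C \<rho> q"]
        finite_set_kernel bridge_quadratic \<rho> q) (auto simp: mult.assoc)
  show ?thesis
  proof unfold_locales
    show "0 < \<bar>\<rho>\<bar>" "\<bar>\<rho>\<bar> < 1" using \<rho>1 by auto
    show "expectation (\<lambda>\<omega>. pt (Y k \<omega>)) = 0" for k
      by (simp add: marginal stat_mean)
  qed (use square corr stationary_X linear quadratic in \<open>simp_all add: F_def\<close>)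
qed

end

theorem mainTheorem1:
  fixes q \<rho> :: real and m :: nat
  assumes "q > 1" and "m \<ge> 1" and "\<rho> = 1 / q ^ m"
  shows "\<exists>(M :: (int \<Rightarrow> real) measure) X. bryc_process M X \<rho> q"
proof -
  \<comment> \<open>With \<open>r = sqrt q\<close> and \<open>n = 2 * m\<close> one has
    \<open>r ^ n = q ^ m\<close>, and \<open>m \<ge> 1\<close> gives
    \<open>2 \<le> n\<close>.\<close>
  interpret q_lattice "sqrt q" using assms(1) by unfold_locales simp
  let ?K = "kernel (2 * m)"
  obtain \<Omega> :: "((int \<times> int) option \<Rightarrow> int) measure" and Y
    where Y: "two_sided_chain \<Omega> Y stat ?K"
    using two_sided_chain_reversible[of stat ?K, OF kernel_reversible] by blast
  let ?B = "Pi\<^sub>M UNIV (\<lambda>_. borel) :: (int \<Rightarrow> real) measure"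
  have meas: "Y k \<in> measurable \<Omega> (count_space UNIV)" for k
    using Y by (rule two_sided_chain.measurable_Y)
  \<comment> \<open>The integer states are embedded into real paths and recovered by the floor, so
    that the probability space has the required type.\<close>
  have "two_sided_chain (distr \<Omega> ?B (\<lambda>\<omega> k. real_of_int (Y k \<omega>))) (\<lambda>k w. \<lfloor>w k\<rfloor>) stat ?K"
  proof (rule two_sided_chain_distr[OF Y])
    show "(\<lambda>\<omega> k. real_of_int (Y k \<omega>)) \<in> measurable \<Omega> ?B"
      by (intro measurable_PiM_single') (auto intro: measurable_compose[OF meas])
  qed auto
  moreover have "\<rho> = 1 / sqrt q ^ (2 * m)"
    using assms by (simp add: power_mult)
  ultimately have "bryc_process (distr \<Omega> ?B (\<lambda>\<omega> k. real_of_int (Y k \<omega>))) (\<lambda>k w. pt \<lfloor>w k\<rfloor>) \<rho> q"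
    using assms by (intro bryc_process_of_chain[where n = "2 * m"]) auto
  then show ?thesis by blast
qed

end
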